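(* Let $G$ be a finite connected graph without tadpoles, with $h_G\ge 1$, and let $T$ be a spanning tree of $G$. Then the map $\pi_T\colon D_T\to C_T$ is a smooth fiber bundle whose fibers are diffeomorphic to (a disjoint union of) $h_G$ copies of $\mathbb R^{e_G-e_T-1}=\mathbb R^{h_G-1}$.
   Context: Graphs. $E_G$ is the set of (internal) edges of $G$, $e_G=|E_G|$, $h_G=\dim H_1(G;\mathbb Q)$. Graphs may have multiple edges; a tadpole is an edge joining a vertex to itself. A subgraph is identified with its edge set and may be disconnected. A graph $\gamma$ is core if removing any one edge reduces its first Betti number by one. Simplex and cubes. In $\mathbb P(\mathbb C^{e_G})$ with coordinates $x_e$, $e\in E_G$, put $\Delta_G=\{[x]\mid x_e>0 \text{ for all } e\}$ and $\overline\Delta_G=\{[x]\mid x_e\ge 0\text{ for all }e\}$. For a spanning tree $T$ of $G$, \[C_T=\{[x]\in\Delta_G\mid 0<x_i<x_j \text{ for all } i\in E_T,\ j\in E_G\setminus E_T,\ \text{and } x_i=x_j\text{ for all } i,j\in E_G\setminus E_T\},\] parametrized by $(0,1)^{e_T}$ by normalizing $x_j=1$ for $j\notin E_T$. The map $\pi_T$. Let \[\mathcal C(T)=\{\gamma\subsetneq G\mid \gamma\text{ core},\ E_\gamma\cap E_T\ne\varnothing,\ E_\gamma\cup E_T\neq E_G\},\] partially ordered by inclusion, and let $\mathcal C_{\max}(T)$ be its set of maximal elements. For $\gamma\in\mathcal C_{\max}(T)$ let $v_\gamma\colon C_T\to\overline\Delta_G$ be the map setting $x_e$ to $0$ for $e\in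 E_\gamma$ and leaving the other coordinates unchanged. Let \[\mathrm{Cone}_x(y_1,\dots,y_n)=\{[x+\mu_1y_1+\dots+\mu_ny_n]\mid \mu_i\in(0,\infty)\},\] where for $y_i=v_{\gamma_i}(x)$ the same homogeneous representative of $x$ is used throughout, and where the cone is $\{[x]\}$ if $n=0$. For $x\in C_T$ put \[\pi_T^{-1}(x)=\bigcup \mathrm{Cone}_x\big(v_{\gamma_1}(x),\dots,v_{\gamma_{h_G-1}}(x)\big),\] the union being over all choices of pairwise different $\gamma_1,\dots,\gamma_{h_G-1}\in\mathcal C_{\max}(T)$. For $x\ne x'$ in $C_T$ these sets are disjoint, so with $D_T=\bigcup_{x\in C_T}\pi_T^{-1}(x)$ there is a well-defined map $\pi_T\colon D_T\to C_T$ sending every point of $\pi_T^{-1}(x)$ to $x$. *)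

theory Defs
  imports "HOL-Analysis.Analysis"
begin

section \<open>Finite multigraphs and their first Betti number\<close>

text \<open>
  A finite graph with vertices \<open>'v\<close> and edges \<open>'e\<close> (both finite types) is given by the
  two ends of every edge. The order of the two ends is an auxiliary orientation, which is used
  only to write down the boundary operator; parallel edges and tadpoles are possible. A subgraph
  is a set of edges, and \<open>UNIV\<close> is the whole graph. The edge type is nonempty, which
  costs no generality for graphs of positive first Betti number.
\<close>

type_synonym ('v, 'e) graph = "'e \<Rightarrow> 'v \<times> 'v"

definition tadpole :: "('v, 'e) graph \<Rightarrow> 'e \<Rightarrow> bool" where
  "tadpole G e \<longleftrightarrow> fst (G e) = snd (G e)"

definition connected_graph :: "('v, 'e) graph \<Rightarrow> 'e set \<Rightarrow> bool" where
  "connected_graph G A \<longleftrightarrow>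
     (\<forall>u v. (u, v) \<in> {(a, b). \<exists>e\<in>A. G e = (a, b) \<or> G e = (b, a)}\<^sup>*)"

definition boundary :: "('v::finite, 'e::finite) graph \<Rightarrow> rat ^ 'e \<Rightarrow> rat ^ 'v" where
  "boundary G z = (\<chi> v. \<Sum>e\<in>UNIV. z $ e * (of_bool (snd (G e) = v) - of_bool (fst (G e) = v)))"

text \<open>
  A graph has no cells of dimension two, so its first rational homology is the kernel of the
  boundary operator on the chains supported in it.
\<close>

definition H1 :: "('v::finite, 'e::finite) graph \<Rightarrow> 'e set \<Rightarrow> (rat ^ 'e) set" where
  "H1 G A = {z. (\<forall>e. e \<notin> A \<longrightarrow> z $ e = 0) \<and> boundary G z = 0}"

definition betti :: "('v::finite, 'e::finite) graph \<Rightarrow> 'e set \<Rightarrow> nat" where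
  "betti G A = vec.dim (H1 G A)"

text \<open>A tree is a connected graph without cycles, that is, with vanishing first homology.\<close>

definition spanning_tree :: "('v::finite, 'e::finite) graph \<Rightarrow> 'e set \<Rightarrow> bool" where
  "spanning_tree G T \<longleftrightarrow> connected_graph G T \<and> betti G T = 0"

definition core :: "('v::finite, 'e::finite) graph \<Rightarrow> 'e set \<Rightarrow> bool" where
  "core G \<gamma> \<longleftrightarrow> (\<forall>e\<in>\<gamma>. betti G (\<gamma> - {e}) + 1 = betti G \<gamma>)"

definition core_subgraphs :: "('v::finite, 'e::finite) graph \<Rightarrow> 'e set \<Rightarrow> 'e set set" where
  "core_subgraphs G T = {\<gamma>. \<gamma> \<subset> UNIV \<and> core G \<gamma> \<and> \<gamma> \<inter> T \<noteq> {} \<and> \<gamma> \<union> T \<noteq> UNIV}"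

definition max_core_subgraphs :: "('v::finite, 'e::finite) graph \<Rightarrow> 'e set \<Rightarrow> 'e set set" where
  "max_core_subgraphs G T =
     {\<gamma> \<in> core_subgraphs G T. \<not> (\<exists>\<gamma>'\<in>core_subgraphs G T. \<gamma> \<subset> \<gamma>')}"


section \<open>Complex projective space, the open simplex and the cubes\<close>

definition proj_pt :: "complex ^ 'e \<Rightarrow> (complex ^ 'e) set" where
  "proj_pt z = {c *s z | c. c \<noteq> 0}"

definition proj_space :: "(complex ^ 'e) set set" where
  "proj_space = {proj_pt z | z. z \<noteq> 0}"

text \<open>The quotient topology.\<close>

definition proj_topology :: "(complex ^ 'e::finite) set topology" where
  "proj_topology = topology (\<lambda>S. S \<subseteq> proj_space \<and> open {z. z \<noteq> 0 \<and> proj_pt z \<in> S})"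

lemma openin_proj_topology:
  fixes S :: "(complex ^ 'e::finite) set set"
  shows "openin proj_topology S \<longleftrightarrow> S \<subseteq> proj_space \<and> open {z. z \<noteq> 0 \<and> proj_pt z \<in> S}"
proof -
  have "istopology (\<lambda>S. S \<subseteq> proj_space \<and> open {z :: complex ^ 'e. z \<noteq> 0 \<and> proj_pt z \<in> S})"
    unfolding istopology_def
  proof (intro conjI allI impI)
    fix S R :: "(complex ^ 'e) set set"
    assume *: "S \<subseteq> proj_space \<and> open {z. z \<noteq> 0 \<and> proj_pt z \<in> S}"
      "R \<subseteq> proj_space \<and> open {z. z \<noteq> 0 \<and> proj_pt z \<in> R}"
    have "{z. z \<noteq> 0 \<and> proj_pt z \<in> S \<inter> R} =
        {z. z \<noteq> 0 \<and> proj_pt z \<in> S} \<inter> {z. z \<noteq> 0 \<and> proj_pt z \<in> R}" by auto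
    then show "open {z. z \<noteq> 0 \<and> proj_pt z \<in> S \<inter> R}" using * by (simp add: open_Int)
    show "S \<inter> R \<subseteq> proj_space" using * by auto
  next
    fix K :: "(complex ^ 'e) set set set"
    assume *: "\<forall>S\<in>K. S \<subseteq> proj_space \<and> open {z. z \<noteq> 0 \<and> proj_pt z \<in> S}"
    have "{z. z \<noteq> 0 \<and> proj_pt z \<in> \<Union> K} = (\<Union>S\<in>K. {z. z \<noteq> 0 \<and> proj_pt z \<in> S})" by auto
    then show "open {z. z \<noteq> 0 \<and> proj_pt z \<in> \<Union> K}" using * by (auto intro!: open_UN)
    show "\<Union> K \<subseteq> proj_space" using * by auto
  qed
  then show ?thesis by (simp add: proj_topology_def)
qed

definition hom_pt :: "real ^ 'e \<Rightarrow> (complex ^ 'e) set" where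
  "hom_pt x = proj_pt (\<chi> e. complex_of_real (x $ e))"

definition open_simplex :: "(complex ^ 'e) set set" where
  "open_simplex = {hom_pt x | x. \<forall>e. 0 < x $ e}"

definition cube :: "'e set \<Rightarrow> (complex ^ 'e) set set" where
  "cube T = {hom_pt x | x. (\<forall>e. 0 < x $ e) \<and>
     (\<forall>i\<in>T. \<forall>j\<in>-T. x $ i < x $ j) \<and> (\<forall>i\<in>-T. \<forall>j\<in>-T. x $ i = x $ j)}"


section \<open>The map from \<open>D\<^sub>T\<close> to the cube\<close>

definition vanish :: "'e set \<Rightarrow> real ^ 'e \<Rightarrow> real ^ 'e" where
  "vanish \<gamma> x = (\<chi> e. if e \<in> \<gamma> then 0 else x $ e)"

definition Cone :: "real ^ 'e::finite \<Rightarrow> (real ^ 'e) list \<Rightarrow> (complex ^ 'e) set set" where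
  "Cone x ys = {hom_pt (x + (\<Sum>i<length ys. \<mu> i *\<^sub>R (ys ! i))) | \<mu> :: nat \<Rightarrow> real.
     \<forall>i<length ys. 0 < \<mu> i}"

text \<open>
  The union over all positive representatives \<open>x\<close> of the point \<open>p\<close> is harmless: rescaling
  \<open>x\<close> rescales all generators of the cone at the same time.
\<close>

definition pi_fiber ::
  "('v::finite, 'e::finite) graph \<Rightarrow> 'e set \<Rightarrow> (complex ^ 'e) set \<Rightarrow> (complex ^ 'e) set set" where
  "pi_fiber G T p = \<Union> {Cone x (map (\<lambda>\<gamma>. vanish \<gamma> x) \<gamma>s) | x \<gamma>s.
     (\<forall>e. 0 < x $ e) \<and> hom_pt x = p \<and>
     length \<gamma>s = betti G UNIV - 1 \<and> distinct \<gamma>s \<and> set \<gamma>s \<subseteq> max_core_subgraphs G T}"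

definition D_T :: "('v::finite, 'e::finite) graph \<Rightarrow> 'e set \<Rightarrow> (complex ^ 'e) set set" where
  "D_T G T = (\<Union>p\<in>cube T. pi_fiber G T p)"

definition pi_T ::
  "('v::finite, 'e::finite) graph \<Rightarrow> 'e set \<Rightarrow> (complex ^ 'e) set \<Rightarrow> (complex ^ 'e) set" where
  "pi_T G T q = (THE p. p \<in> cube T \<and> q \<in> pi_fiber G T p)"


section \<open>Smooth manifolds, smooth maps and smooth fiber bundles\<close>

text \<open>
  The model of $n$-dimensional space is \<^const>\<open>Euclidean_space\<close>: sequences vanishing from
  index \<open>n\<close> on. For a set \<open>U\<close> that is open in it, \<open>Ck_on k n U f\<close> says
  that all iterated partial derivatives of \<open>f\<close> up to order \<open>k\<close> exist and are
  continuous on \<open>U\<close>.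
\<close>

primrec Ck_on :: "nat \<Rightarrow> nat \<Rightarrow> (nat \<Rightarrow> real) set \<Rightarrow> ((nat \<Rightarrow> real) \<Rightarrow> real) \<Rightarrow> bool" where
  "Ck_on 0 n U f \<longleftrightarrow> continuous_on U f"
| "Ck_on (Suc k) n U f \<longleftrightarrow> continuous_on U f \<and>
     (\<forall>i<n. \<exists>g. (\<forall>x\<in>U. ((\<lambda>t. f (x(i := t))) has_real_derivative g x) (at (x i))) \<and> Ck_on k n U g)"

definition smooth_on ::
  "nat \<Rightarrow> nat \<Rightarrow> (nat \<Rightarrow> real) set \<Rightarrow> ((nat \<Rightarrow> real) \<Rightarrow> nat \<Rightarrow> real) \<Rightarrow> bool" where
  "smooth_on n m U f \<longleftrightarrow> (\<forall>j<m. \<forall>k. Ck_on k n U (\<lambda>x. f x j))"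

text \<open>A chart is its domain together with its coordinate map.\<close>

record 'a manifold =
  mtop :: "'a topology"
  mdim :: nat
  atlas :: "('a set \<times> ('a \<Rightarrow> nat \<Rightarrow> real)) set"

definition smooth_manifold :: "'a manifold \<Rightarrow> bool" where
  "smooth_manifold M \<longleftrightarrow>
     Hausdorff_space (mtop M) \<and> second_countable (mtop M) \<and>
     (\<Union>(U, \<phi>)\<in>atlas M. U) = topspace (mtop M) \<and>
     (\<forall>(U, \<phi>)\<in>atlas M.
        openin (mtop M) U \<and> openin (Euclidean_space (mdim M)) (\<phi> ` U) \<and>
        homeomorphic_map (subtopology (mtop M) U)
          (subtopology (Euclidean_space (mdim M)) (\<phi> ` U)) \<phi>) \<and>
     (\<forall>(U, \<phi>)\<in>atlas M. \<forall>(V, \<psi>)\<in>atlas M.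
        smooth_on (mdim M) (mdim M) (\<phi> ` (U \<inter> V)) (\<psi> \<circ> inv_into U \<phi>))"

definition smooth_map :: "'a manifold \<Rightarrow> 'b manifold \<Rightarrow> ('a \<Rightarrow> 'b) \<Rightarrow> bool" where
  "smooth_map M N f \<longleftrightarrow>
     continuous_map (mtop M) (mtop N) f \<and>
     (\<forall>(U, \<phi>)\<in>atlas M. \<forall>(V, \<psi>)\<in>atlas N.
        smooth_on (mdim M) (mdim N) (\<phi> ` {p \<in> U. f p \<in> V}) (\<psi> \<circ> f \<circ> inv_into U \<phi>))"

definition diffeomorphism :: "'a manifold \<Rightarrow> 'b manifold \<Rightarrow> ('a \<Rightarrow> 'b) \<Rightarrow> bool" where
  "diffeomorphism M N f \<longleftrightarrow>
     bij_betw f (topspace (mtop M)) (topspace (mtop N)) \<and>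
     smooth_map M N f \<and> smooth_map N M (inv_into (topspace (mtop M)) f)"

text \<open>Meaningful for open \<open>S\<close> only.\<close>

definition open_submanifold :: "'a manifold \<Rightarrow> 'a set \<Rightarrow> 'a manifold" where
  "open_submanifold M S =
     \<lparr>mtop = subtopology (mtop M) S, mdim = mdim M,
      atlas = {(U \<inter> S, \<phi>) | U \<phi>. (U, \<phi>) \<in> atlas M}\<rparr>"

definition prod_manifold :: "'a manifold \<Rightarrow> 'b manifold \<Rightarrow> ('a \<times> 'b) manifold" where
  "prod_manifold M N =
     \<lparr>mtop = prod_topology (mtop M) (mtop N), mdim = mdim M + mdim N,
      atlas = {(U \<times> V, \<lambda>(x, y) i. if i < mdim M then \<phi> x i else \<psi> y (i - mdim M)) | U \<phi> V \<psi>.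
        (U, \<phi>) \<in> atlas M \<and> (V, \<psi>) \<in> atlas N}\<rparr>"

definition Euclidean_manifold :: "nat \<Rightarrow> (nat \<Rightarrow> real) manifold" where
  "Euclidean_manifold n =
     \<lparr>mtop = Euclidean_space n, mdim = n, atlas = {(topspace (Euclidean_space n), id)}\<rparr>"

text \<open>The disjoint union of \<open>k\<close> copies of a manifold.\<close>

definition copies :: "nat \<Rightarrow> 'a manifold \<Rightarrow> (nat \<times> 'a) manifold" where
  "copies k M =
     \<lparr>mtop = prod_topology (discrete_topology {..<k}) (mtop M), mdim = mdim M,
      atlas = {({l} \<times> U, \<phi> \<circ> snd) | l U \<phi>. l < k \<and> (U, \<phi>) \<in> atlas M}\<rparr>"

definition smooth_fiber_bundle ::
  "'a manifold \<Rightarrow> 'b manifold \<Rightarrow> 'c manifold \<Rightarrow> ('a \<Rightarrow> 'b) \<Rightarrow> bool" where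
  "smooth_fiber_bundle E B F \<pi> \<longleftrightarrow>
     smooth_manifold E \<and> smooth_manifold B \<and> smooth_manifold F \<and>
     smooth_map E B \<pi> \<and> \<pi> ` topspace (mtop E) = topspace (mtop B) \<and>
     (\<forall>b\<in>topspace (mtop B). \<exists>U \<phi>. openin (mtop B) U \<and> b \<in> U \<and>
        diffeomorphism (open_submanifold E {p \<in> topspace (mtop E). \<pi> p \<in> U})
          (prod_manifold (open_submanifold B U) F) \<phi> \<and>
        (\<forall>p\<in>topspace (mtop E). \<pi> p \<in> U \<longrightarrow> fst (\<phi> p) = \<pi> p))"


section \<open>The smooth structures on the simplex, on \<open>D\<^sub>T\<close> and on the cube\<close>

text \<open>The quotient of two homogeneous coordinates of a point of the open simplex.\<close>

definition ratio :: "(complex ^ 'e) set \<Rightarrow> 'e \<Rightarrow> 'e \<Rightarrow> real" where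
  "ratio p f e = Re ((SOME z. z \<in> p) $ f / (SOME z. z \<in> p) $ e)"

text \<open>
  Normalize the coordinate with index \<open>e\<close> to 1 and list the coordinates with indices
  \<open>b 0, \<dots>, b (n - 1)\<close>.
\<close>

definition affine_coords :: "nat \<Rightarrow> (nat \<Rightarrow> 'e) \<Rightarrow> 'e \<Rightarrow> (complex ^ 'e) set \<Rightarrow> nat \<Rightarrow> real" where
  "affine_coords n b e p = (\<lambda>i. if i < n then ratio p (b i) e else 0)"

text \<open>
  The open simplex is the part of real projective space with positive coordinates; its smooth
  structure is given by the affine charts, with all enumerations \<open>b\<close> of the coordinates
  other than the normalized one.
\<close>

definition simplex_manifold :: "(complex ^ 'e::finite) set manifold" where
  "simplex_manifold =
     \<lparr>mtop = subtopology proj_topology open_simplex, mdim = CARD('e) - 1,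
      atlas = {(open_simplex, affine_coords (CARD('e) - 1) b e) | b e.
        bij_betw b {..<CARD('e) - 1} (- {e})}\<rparr>"

definition D_manifold ::
  "('v::finite, 'e::finite) graph \<Rightarrow> 'e set \<Rightarrow> (complex ^ 'e) set manifold" where
  "D_manifold G T = open_submanifold simplex_manifold (D_T G T)"

text \<open>
  The smooth structure of the cube is given by its parametrization by the points of
  $(0,1)^{e_T}$, where the coordinates outside \<open>T\<close> are normalized to 1.
\<close>

definition cube_manifold :: "'e::finite set \<Rightarrow> (complex ^ 'e) set manifold" where
  "cube_manifold T =
     \<lparr>mtop = subtopology proj_topology (cube T), mdim = card T,
      atlas = {(cube T, affine_coords (card T) b e) | b e.
        e \<notin> T \<and> bij_betw b {..<card T} T}\<rparr>"

end

theory Submission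
  imports Defs
begin

text \<open>
  Let \<open>S\<close> be the complement of \<open>T\<close>, which has \<open>h\<close> elements. A core
  subgraph is a union of supports of cycles, so for every \<open>s \<in> S\<close> there is a largest core subgraph
  \<open>\<gamma> s\<close> avoiding \<open>s\<close>. It contains the fundamental cycles of all other elements
  of \<open>S\<close>, hence \<open>\<gamma> s \<inter> S = S - {s}\<close>. If \<open>h \<ge> 2\<close>, these are
  exactly the maximal elements of the poset of core subgraphs, and choosing \<open>h - 1\<close> of them means to
  omit one \<open>s\<^sub>0 \<in> S\<close>; if \<open>h = 1\<close>, the poset is empty and so is the
  list of generators of the cone, which again corresponds to omitting the only element of \<open>S\<close>.

  For \<open>x\<close> with \<open>x s = 1\<close> on \<open>S\<close>, the point of the cone with
  weights \<open>\<mu> s\<close> (and \<open>\<mu> s\<^sub>0 = 0\<close>) has the coordinates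
  \<open>y e = x e * (1 + (\<Sum>s. if e \<in> \<gamma> s then 0 else \<mu> s))\<close>, in particular
  \<open>y s = 1 + \<mu> s\<close> for \<open>s \<in> S\<close>. So \<open>s\<^sub>0\<close> is the unique
  minimum of \<open>y\<close> on \<open>S\<close>, and \<open>\<mu>\<close> and then \<open>x\<close> are rational
  functions of \<open>y\<close>. The total space is therefore the disjoint union of \<open>h\<close> open pieces,
  one for every \<open>s\<^sub>0\<close>, and \<open>(x, s\<^sub>0, ln \<mu>)\<close> is a global trivialization.
\<close>

section \<open>Core subgraphs and spanning trees\<close>

text \<open>Adding a positive multiple of \<open>vanish \<gamma> x\<close> to x rescales every
  coordinate of x separately. On S the rescaling factor at t involves a single weight, since
  \<gamma> t is the only one of the sets \<gamma> s that misses t. The inversion is therefore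
  explicit: weights are read off on S, then one division gives x. The uniqueness behind the definite
  description in \<open>pi_T\<close> comes out of the same computation. The absence of tadpoles is
  what makes a fundamental cycle run through T, so that \<gamma> s meets T and belongs to the poset.
  The logarithm turns the positive weights into arbitrary reals, so that a fiber becomes h full
  copies of Euclidean space. The main obstacle is that the index of \<open>\<sigma>\<close> at the
  minimum is not given by one formula. Each piece is cut out by finitely many strict inequalities
  between continuous functions, hence is open; continuity and smoothness are checked piece by piece
  with explicit formulas. The same openness makes the total space an open part of the simplex, as
  \<open>open_submanifold\<close> presupposes.\<close>

lemma boundary_add: "boundary G (y + z) = boundary G y + boundary G z"
  by (simp add: boundary_def vec_eq_iff distrib_right sum.distrib[symmetric])

lemma boundary_scale: "boundary G (c *s z) = c *s boundary G z"
  by (simp add: boundary_def vec_eq_iff sum_distrib_left mult.assoc)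

lemma boundary_axis: "boundary G (axis e 1) = axis (snd (G e)) 1 - axis (fst (G e)) 1"
proof -
  have "(\<Sum>e'\<in>UNIV. (axis e 1 :: rat ^ 'b) $ e' * f e') = f e" for f :: "'b \<Rightarrow> rat"
    by (simp add: axis_def if_distrib[of "\<lambda>x. x * _"] cong: if_cong)
  then show ?thesis
    by (simp add: boundary_def vec_eq_iff axis_def)
qed

lemma H1_mono: "A \<subseteq> B \<Longrightarrow> H1 G A \<subseteq> H1 G B"
  by (auto simp: H1_def)

lemma subspace_H1: "vec.subspace (H1 G A)"
  by (auto simp: vec.subspace_def H1_def boundary_add boundary_scale)
     (simp add: boundary_def vec_eq_iff)

text \<open>Deleting e replaces \<open>H1 G A\<close> by the kernel of the linear functional reading
  the coefficient at e. The dimension drops by one exactly when this functional is nonzero, and any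
  cycle z through e spans a complement.\<close>

lemma betti_remove_edge: "betti G (A - {e}) + 1 = betti G A \<longleftrightarrow> (\<exists>z\<in>H1 G A. z $ e \<noteq> 0)"
proof (cases "\<exists>z\<in>H1 G A. z $ e \<noteq> 0")
  case True
  then obtain z where z: "z \<in> H1 G A" "z $ e \<noteq> 0" by blast
  have span: "vec.span (H1 G (A - {e})) = H1 G (A - {e})"
    by (rule vec.span_eq_iff[THEN iffD2, OF subspace_H1])
  have "vec.span (insert z (H1 G (A - {e}))) = H1 G A"
  proof (intro equalityI subsetI)
    fix w assume "w \<in> vec.span (insert z (H1 G (A - {e})))"
    moreover have "insert z (H1 G (A - {e})) \<subseteq> H1 G A"
      using z H1_mono[of "A - {e}" A G] by auto
    ultimately show "w \<in> H1 G A"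
      using vec.span_minimal[OF _ subspace_H1] by blast
  next
    fix w assume w: "w \<in> H1 G A"
    \<comment> \<open>Subtracting this multiple of z cancels the coefficient of w at e.\<close>
    define c where "c = w $ e / z $ e"
    have "w - c *s z \<in> H1 G A"
      using w z subspace_H1 vec.subspace_diff vec.subspace_scale by blast
    moreover have "(w - c *s z) $ e = 0" using z by (simp add: c_def)
    ultimately have "w - c *s z \<in> H1 G (A - {e})"
      by (auto simp: H1_def)
    then show "w \<in> vec.span (insert z (H1 G (A - {e})))"
      unfolding vec.span_breakdown_eq using span by blast
  qed
  then have "betti G A = vec.dim (insert z (H1 G (A - {e})))"
    unfolding betti_def by (metis vec.dim_span)
  moreover have "z \<notin> H1 G (A - {e})" using z by (auto simp: H1_def)
  ultimately show ?thesis using True by (simp add: vec.dim_insert span betti_def)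
next
  case False
  then have "H1 G (A - {e}) = H1 G A"
    by (auto simp: H1_def)
  then show ?thesis using False by (simp add: betti_def)
qed

lemma core_iff: "core G A \<longleftrightarrow> (\<forall>e\<in>A. \<exists>z\<in>H1 G A. z $ e \<noteq> 0)"
  unfolding core_def betti_remove_edge ..

text \<open>The signed sum of the edges along a path from u to v has this boundary; the chain grows
  with the path.\<close>

lemma connected_graph_chain:
  assumes "connected_graph G A"
  shows "\<exists>z. (\<forall>e. e \<notin> A \<longrightarrow> z $ e = 0) \<and> boundary G z = axis v 1 - axis u 1"
proof -
  have "(u, v) \<in> {(a, b). \<exists>e\<in>A. G e = (a, b) \<or> G e = (b, a)}\<^sup>*"
    using assms by (simp add: connected_graph_def)
  then show ?thesis
  proof (induction rule: rtrancl_induct)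
    case base
    have "boundary G 0 = 0" by (simp add: boundary_def vec_eq_iff)
    then show ?case by (intro exI[of _ 0]) simp
  next
    case (step a b)
    then obtain z e where z: "\<forall>e. e \<notin> A \<longrightarrow> z $ e = 0" "boundary G z = axis a 1 - axis u 1"
      and e: "e \<in> A" "G e = (a, b) \<or> G e = (b, a)" by blast
    \<comment> \<open>The sign makes the edge run from a to b, whatever its auxiliary
      orientation.\<close>
    define c :: rat where "c = (if G e = (a, b) then 1 else - 1)"
    have "boundary G (z + c *s axis e 1) = axis b 1 - axis u 1"
      using e by (auto simp: boundary_add boundary_scale boundary_axis z c_def)
    moreover have "\<forall>e'. e' \<notin> A \<longrightarrow> (z + c *s axis e 1) $ e' = 0"
      using z e by (auto simp: axis_def)
    ultimately show ?case by blast
  qed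
qed

text \<open>The edge s is closed up by a chain in T from its head back to its tail. That chain
  vanishes at s, so the coefficient there stays 1.\<close>

lemma fundamental_cycle:
  assumes "connected_graph G T" "s \<notin> T"
  shows "\<exists>z\<in>H1 G (insert s T). z $ s = 1"
proof -
  obtain z where z: "\<forall>e. e \<notin> T \<longrightarrow> z $ e = 0"
    "boundary G z = axis (fst (G s)) 1 - axis (snd (G s)) 1"
    using connected_graph_chain[OF assms(1)] by blast
  have "boundary G (z + axis s 1) = 0"
    by (simp add: boundary_add boundary_axis z)
  then have "z + axis s 1 \<in> H1 G (insert s T)"
    using z by (auto simp: H1_def axis_def)
  moreover have "(z + axis s 1) $ s = 1" using z assms(2) by (simp add: axis_def)
  ultimately show ?thesis by blast
qed

text \<open>Each edge added to the tree lies on its own fundamental cycle, so by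
  \<open>betti_remove_edge\<close> it raises the Betti number by one.\<close>

lemma betti_tree_union:
  assumes "spanning_tree G T" "B \<inter> T = {}"
  shows "betti G (T \<union> B) = card B"
  using finite[of B] assms(2)
proof (induction B)
  case empty
  then show ?case using assms(1) by (simp add: spanning_tree_def)
next
  case (insert s B)
  obtain z where "z \<in> H1 G (insert s T)" "z $ s = 1"
    using fundamental_cycle[of G T s] assms(1) insert.prems by (auto simp: spanning_tree_def)
  then have "\<exists>z\<in>H1 G (T \<union> insert s B). z $ s \<noteq> 0"
    using H1_mono[of "insert s T" "T \<union> insert s B" G]
    by (metis Un_insert_right Un_upper1 insert_mono subsetD zero_neq_one)
  then have "betti G (T \<union> insert s B - {s}) + 1 = betti G (T \<union> insert s B)"
    by (simp only: betti_remove_edge)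
  moreover have "T \<union> insert s B - {s} = T \<union> B" using insert by auto
  ultimately show ?case using insert by auto
qed

lemma betti_eq_card_compl: "spanning_tree G T \<Longrightarrow> betti G UNIV = card (- T)"
  using betti_tree_union[of G T "- T"] by simp

text \<open>This is \<gamma> s of the overview, encoded as the union of the supports of all cycles
  that avoid s.\<close>

definition core_without :: "('v::finite, 'e::finite) graph \<Rightarrow> 'e \<Rightarrow> 'e set" where
  "core_without G s = {e. \<exists>z\<in>H1 G (- {s}). z $ e \<noteq> 0}"

lemma not_in_core_without: "s \<notin> core_without G s"
  by (auto simp: core_without_def H1_def)

text \<open>Passing to the union of the supports loses no cycle, so every edge in it still has a
  cycle through it.\<close>

lemma core_core_without: "core G (core_without G s)"
proof -
  have "H1 G (core_without G s) = H1 G (- {s})"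
    by (auto simp: core_without_def H1_def)
  then show ?thesis by (auto simp: core_iff core_without_def)
qed

lemma core_subset_core_without:
  assumes "core G A" "s \<notin> A"
  shows "A \<subseteq> core_without G s"
  using assms H1_mono[of A "- {s}" G] unfolding core_iff core_without_def by blast

text \<open>The fundamental cycle of t uses only t and tree edges, hence avoids every other s off
  T.\<close>

lemma in_core_without_iff:
  assumes "connected_graph G T" "s \<notin> T" "t \<notin> T"
  shows "t \<in> core_without G s \<longleftrightarrow> t \<noteq> s"
proof
  assume "t \<noteq> s"
  obtain z where z: "z \<in> H1 G (insert t T)" "z $ t = 1"
    using fundamental_cycle[OF assms(1,3)] by blast
  moreover have "insert t T \<subseteq> - {s}" using assms \<open>t \<noteq> s\<close> by auto
  ultimately show "t \<in> core_without G s"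
    using H1_mono[of "insert t T" "- {s}" G] unfolding core_without_def by force
qed (use not_in_core_without in auto)

text \<open>Any member A of the poset misses some s off T and so lies in
  \<open>core_without G s\<close>, which then meets T as well; maximality forces equality.
  Conversely the sets \<open>core_without G s\<close> are pairwise incomparable because their traces
  off T are.\<close>

lemma max_core_subgraphs_subset:
  assumes "spanning_tree G T" "\<forall>e. \<not> tadpole G e"
  shows "max_core_subgraphs G T \<subseteq> core_without G ` (- T)"
    and "2 \<le> card (- T) \<Longrightarrow> core_without G ` (- T) \<subseteq> max_core_subgraphs G T"
proof -
  have conn: "connected_graph G T" using assms(1) by (simp add: spanning_tree_def)
  have sub: "\<exists>s\<in>-T. A \<subseteq> core_without G s" if "A \<in> core_subgraphs G T" for A
    using that core_subset_core_without unfolding core_subgraphs_def by blast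
  have mem: "core_without G s \<in> core_subgraphs G T"
    if s: "s \<in> - T" and A: "A \<subseteq> core_without G s" "A \<inter> T \<noteq> {}" for s A
    using s A not_in_core_without[of s G] core_core_without[of G s]
    unfolding core_subgraphs_def by blast
  show "max_core_subgraphs G T \<subseteq> core_without G ` (- T)"
  proof
    fix A assume A: "A \<in> max_core_subgraphs G T"
    then have A': "A \<in> core_subgraphs G T" by (simp add: max_core_subgraphs_def)
    then obtain s where s: "s \<in> - T" "A \<subseteq> core_without G s" using sub by blast
    have "core_without G s \<in> core_subgraphs G T"
      using mem[OF s] A' by (auto simp: core_subgraphs_def)
    then have "A = core_without G s" using A s by (auto simp: max_core_subgraphs_def)
    then show "A \<in> core_without G ` (- T)" using s by blast
  qed
  assume card: "2 \<le> card (- T)"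
  show "core_without G ` (- T) \<subseteq> max_core_subgraphs G T"
  proof (intro image_subsetI)
    fix s assume s: "s \<in> - T"
    have "\<not> - T \<subseteq> {s}"
      using card card_mono[of "{s}" "- T"] by auto
    \<comment> \<open>The second edge t off T supplies a cycle avoiding s; this is where at least
      two edges off T are required.\<close>
    then obtain t where t: "t \<in> - T" "t \<noteq> s" by blast
    obtain z where z: "z \<in> H1 G (insert t T)" "z $ t = 1"
      using fundamental_cycle[OF conn] t by blast
    \<comment> \<open>Otherwise the cycle is the single edge t, whose zero boundary means that its
      two ends coincide.\<close>
    have "\<exists>e\<in>T. z $ e \<noteq> 0"
    proof (rule ccontr)
      assume "\<not> ?thesis"
      then have "z = axis t 1"
        using z t by (auto simp: vec_eq_iff axis_def H1_def)
      then have "axis (snd (G t)) 1 - axis (fst (G t)) (1::rat) = 0"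
        using z boundary_axis[of G t] by (simp add: H1_def)
      then have "axis (snd (G t)) 1 $ snd (G t) = (axis (fst (G t)) (1::rat)) $ snd (G t)"
        by simp
      then have "fst (G t) = snd (G t)" by (simp add: axis_def split: if_splits)
      then show False using assms(2) by (auto simp: tadpole_def)
    qed
    moreover have "z \<in> H1 G (- {s})"
      using z H1_mono[of "insert t T" "- {s}" G] s t by blast
    ultimately have "core_without G s \<inter> T \<noteq> {}"
      unfolding core_without_def by blast
    then have 1: "core_without G s \<in> core_subgraphs G T" using mem[OF s order_refl] by blast
    have "\<not> core_without G s \<subset> A" if A: "A \<in> core_subgraphs G T" for A
    proof
      assume less: "core_without G s \<subset> A"
      \<comment> \<open>A strictly larger A is again contained in some
        \<open>core_without G s'\<close>. Then s' is missing from \<open>core_without G s\<close>,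
        which leaves only s' = s.\<close>
      obtain s' where s': "s' \<in> - T" "A \<subseteq> core_without G s'" using sub[OF A] by blast
      then have "s' \<notin> core_without G s" using less not_in_core_without[of s' G] by blast
      then have "s' = s" using in_core_without_iff[OF conn] s s' by auto
      then show False using less s' by blast
    qed
    then show "core_without G s \<in> max_core_subgraphs G T"
      using 1 by (auto simp: max_core_subgraphs_def)
  qed
qed

section \<open>Iterated partial derivatives\<close>

lemma Euclidean_space_eq_top_of_set: "Euclidean_space n = top_of_set {x. \<forall>i\<ge>n. x i = 0}"
  by (simp add: Euclidean_space_def euclidean_product_topology)

lemma Ck_on_SucI:
  assumes "continuous_on U f"
    and "\<And>i x. i < n \<Longrightarrow> x \<in> U \<Longrightarrow> ((\<lambda>t. f (x(i := t))) has_real_derivative g i x) (at (x i))"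
    and "\<And>i. i < n \<Longrightarrow> Ck_on k n U (g i)"
  shows "Ck_on (Suc k) n U f"
  using assms by auto

text \<open>Collects the separate existential derivatives into one family indexed by i, in the form
  that the calculus rules consume.\<close>

lemma Ck_on_SucE:
  assumes "Ck_on (Suc k) n U f"
  shows "\<exists>g. (\<forall>i<n. \<forall>x\<in>U. ((\<lambda>t. f (x(i := t))) has_real_derivative g i x) (at (x i))) \<and>
    (\<forall>i<n. Ck_on k n U (g i))"
proof -
  have "\<forall>i. \<exists>g. i < n \<longrightarrow> (\<forall>x\<in>U. ((\<lambda>t. f (x(i := t))) has_real_derivative g x) (at (x i))) \<and> Ck_on k n U g"
    using assms by simp
  then obtain g where "\<forall>i. i < n \<longrightarrow> (\<forall>x\<in>U. ((\<lambda>t. f (x(i := t))) has_real_derivative g i x) (at (x i))) \<and> Ck_on k n U (g i)"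
    by (rule choice[THEN exE])
  then show ?thesis by (intro exI[of _ g]) simp
qed

text \<open>Varying a coordinate with index below n does not leave the model space, so relative
  openness is enough for derivatives to be local.\<close>

lemma eventually_upd_in_open:
  assumes "openin (Euclidean_space n) U" "x \<in> U" "i < n"
  shows "\<forall>\<^sub>F t in nhds (x i). x(i := t) \<in> U"
proof -
  obtain W where W: "open W" "U = {x. \<forall>i\<ge>n. x i = 0} \<inter> W"
    using assms(1) by (auto simp: Euclidean_space_eq_top_of_set openin_open)
  have "continuous_on UNIV (\<lambda>t. (x(i := t)))"
  proof (intro continuous_on_coordinatewise_then_product)
    show "continuous_on UNIV (\<lambda>t. (x(i := t)) j)" for j
      by (cases "j = i") simp_all
  qed
  then have "open ((\<lambda>t. x(i := t)) -` W)"
    using W(1) by (simp add: open_vimage)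
  moreover have "x i \<in> (\<lambda>t. x(i := t)) -` W"
    using assms W by simp
  ultimately have "\<forall>\<^sub>F t in nhds (x i). x(i := t) \<in> W"
    by (metis (mono_tags, lifting) eventually_nhds vimage_eq)
  then show ?thesis
    by eventually_elim (use assms W in auto)
qed

text \<open>Openness matters because a partial derivative at x looks at neighbouring values. The
  lemma serves to replace coordinate expressions containing \<open>inv_into\<close> by explicit
  formulas.\<close>

lemma Ck_on_cong_open:
  assumes U: "openin (Euclidean_space n) U" and eq: "\<And>x. x \<in> U \<Longrightarrow> f x = g x"
    and f: "Ck_on k n U f"
  shows "Ck_on k n U g"
proof (cases k)
  case 0
  then show ?thesis using f eq by (auto cong: continuous_on_cong)
next
  case (Suc m)
  have "\<exists>d. (\<forall>x\<in>U. ((\<lambda>t. g (x(i := t))) has_real_derivative d x) (at (x i))) \<and> Ck_on m n U d"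
    if i: "i < n" for i
  proof -
    have "\<exists>d. (\<forall>x\<in>U. ((\<lambda>t. f (x(i := t))) has_real_derivative d x) (at (x i))) \<and> Ck_on m n U d"
      using f Suc i by simp
    then obtain d where d: "\<forall>x\<in>U. ((\<lambda>t. f (x(i := t))) has_real_derivative d x) (at (x i))"
      "Ck_on m n U d"
      by blast
    have "((\<lambda>t. g (x(i := t))) has_real_derivative d x) (at (x i))" if x: "x \<in> U" for x
    proof -
      have "\<forall>\<^sub>F t in nhds (x i). f (x(i := t)) = g (x(i := t))"
        using eventually_upd_in_open[OF U x i] by eventually_elim (rule eq)
      from DERIV_cong_ev[OF refl this refl] d(1)[rule_format, OF x] show ?thesis by (rule iffD1)
    qed
    then show ?thesis using d(2) by blast
  qed
  then show ?thesis using f Suc eq by (auto cong: continuous_on_cong)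
qed

lemma Ck_on_imp_continuous_on: "Ck_on k n U f \<Longrightarrow> continuous_on U f"
  by (cases k) auto

lemma continuous_on_open_cover:
  fixes f :: "(nat \<Rightarrow> real) \<Rightarrow> real"
  assumes cover: "\<And>x. x \<in> U \<Longrightarrow>
    \<exists>V. x \<in> V \<and> V \<subseteq> U \<and> openin (Euclidean_space n) V \<and> continuous_on V f"
  shows "continuous_on U f"
proof -
  define \<V> where "\<V> = {V. V \<subseteq> U \<and> openin (Euclidean_space n) V \<and> continuous_on V f}"
  have "continuous_map (top_of_set U) euclidean f"
  proof (rule pasting_lemma[where I = \<V> and T = id and f = "\<lambda>_. f"])
    fix V assume V: "V \<in> \<V>"
    have "U \<subseteq> topspace (Euclidean_space n)"
      using cover openin_subset by blast
    then show "openin (top_of_set U) (id V)"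
      using V by (auto simp: \<V>_def Euclidean_space_eq_top_of_set intro: openin_subset_trans)
    show "continuous_map (subtopology (top_of_set U) (id V)) euclidean f"
      using V by (simp add: \<V>_def subtopology_subtopology Int_absorb1)
  next
    fix x assume "x \<in> topspace (top_of_set U)"
    then show "\<exists>V. V \<in> \<V> \<and> x \<in> id V \<and> f x = f x"
      using cover[of x] by (auto simp: \<V>_def)
  qed auto
  then show ?thesis by simp
qed

text \<open>Smoothness is local. This is what allows the projection to be treated on each piece of
  the total space by itself.\<close>

lemma Ck_on_open_cover:
  assumes "\<And>x. x \<in> U \<Longrightarrow> \<exists>V. x \<in> V \<and> V \<subseteq> U \<and> openin (Euclidean_space n) V \<and> Ck_on k n V f"
  shows "Ck_on k n U f"
  using assms
proof (induction k arbitrary: f)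
  case 0
  then show ?case using continuous_on_open_cover[of U n f] by simp
next
  case (Suc k)
  have "\<exists>g. (\<forall>x\<in>U. ((\<lambda>t. f (x(i := t))) has_real_derivative g x) (at (x i))) \<and> Ck_on k n U g"
    if i: "i < n" for i
  proof -
    \<comment> \<open>The derivatives supplied on different V must be glued; \<open>deriv\<close> is
      one global function that agrees with all of them by uniqueness of derivatives.\<close>
    define g where "g x = deriv (\<lambda>t. f (x(i := t))) (x i)" for x
    have *: "\<exists>V. x \<in> V \<and> V \<subseteq> U \<and> openin (Euclidean_space n) V \<and> Ck_on k n V g \<and>
        ((\<lambda>t. f (x(i := t))) has_real_derivative g x) (at (x i))" if x: "x \<in> U" for x
    proof -
      obtain V where V: "x \<in> V" "V \<subseteq> U" "openin (Euclidean_space n) V" "Ck_on (Suc k) n V f"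
        using Suc.prems[OF x] by blast
      have "\<exists>d. (\<forall>y\<in>V. ((\<lambda>t. f (y(i := t))) has_real_derivative d y) (at (y i))) \<and> Ck_on k n V d"
        using V(4) i by simp
      then obtain d where d: "\<forall>y\<in>V. ((\<lambda>t. f (y(i := t))) has_real_derivative d y) (at (y i))"
        "Ck_on k n V d"
        by blast
      have dg: "d y = g y" if "y \<in> V" for y
        using DERIV_imp_deriv[OF d(1)[rule_format, OF that]] by (simp add: g_def)
      have "Ck_on k n V g" by (rule Ck_on_cong_open[OF V(3) dg d(2)])
      moreover have "((\<lambda>t. f (x(i := t))) has_real_derivative g x) (at (x i))"
        using d(1)[rule_format, OF V(1)] dg[OF V(1)] by simp
      ultimately show ?thesis using V(1-3) by (intro exI[of _ V]) simp
    qed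
    have "Ck_on k n U g" by (rule Suc.IH) (drule *, fast)
    moreover have "\<forall>x\<in>U. ((\<lambda>t. f (x(i := t))) has_real_derivative g x) (at (x i))"
      by (intro ballI) (drule *, fast)
    ultimately show ?thesis by (intro exI[of _ g]) simp
  qed
  moreover have "continuous_on U f"
    using Suc.prems Ck_on_imp_continuous_on[of "Suc k" n _ f]
    by (intro continuous_on_open_cover[of U n]) meson
  ultimately show ?case by simp
qed

lemma Ck_on_SucD: "Ck_on (Suc k) n U f \<Longrightarrow> Ck_on k n U f"
proof (induction k arbitrary: f)
  case (Suc k)
  have "\<exists>g. (\<forall>x\<in>U. ((\<lambda>t. f (x(i := t))) has_real_derivative g x) (at (x i))) \<and> Ck_on k n U g"
    if "i < n" for i
  proof -
    obtain g where "\<forall>x\<in>U. ((\<lambda>t. f (x(i := t))) has_real_derivative g x) (at (x i))" "Ck_on (Suc k) n U g"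
      using Ck_on_SucE[OF Suc.prems] \<open>i < n\<close> by blast
    then show ?thesis using Suc.IH[of g] by (intro exI[of _ g]) simp
  qed
  then show ?case using Suc.prems by simp
qed simp

section \<open>Calculus rules for functions with continuous iterated partial derivatives\<close>

lemma Ck_on_const: "Ck_on k n U (\<lambda>x. c)"
proof (induction k arbitrary: c)
  case (Suc k)
  show ?case by (rule Ck_on_SucI[where g = "\<lambda>i x. 0"]) (auto intro: Suc)
qed simp

lemma Ck_on_proj: "Ck_on k n U (\<lambda>x. x j)"
proof (cases k)
  case 0
  then show ?thesis by (auto intro: continuous_on_product_then_coordinatewise continuous_on_id)
next
  case (Suc m)
  have "Ck_on (Suc m) n U (\<lambda>x. x j)"
  proof (rule Ck_on_SucI[where g = "\<lambda>i x. of_bool (i = j)"])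
    show "continuous_on U (\<lambda>x. x j)"
      by (auto intro: continuous_on_product_then_coordinatewise continuous_on_id)
    show "((\<lambda>t. (x(i := t)) j) has_real_derivative of_bool (i = j)) (at (x i))" for i x
      by (cases "i = j") auto
  qed (rule Ck_on_const)
  then show ?thesis using Suc by simp
qed

lemma Ck_on_add: "Ck_on k n U f \<Longrightarrow> Ck_on k n U g \<Longrightarrow> Ck_on k n U (\<lambda>x. f x + g x)"
proof (induction k arbitrary: f g)
  case 0
  then show ?case by (auto intro: continuous_intros)
next
  case (Suc k)
  obtain f' where f': "\<forall>i<n. \<forall>x\<in>U. ((\<lambda>t. f (x(i := t))) has_real_derivative f' i x) (at (x i))"
    "\<forall>i<n. Ck_on k n U (f' i)" using Ck_on_SucE[OF Suc.prems(1)] by blast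
  obtain g' where g': "\<forall>i<n. \<forall>x\<in>U. ((\<lambda>t. g (x(i := t))) has_real_derivative g' i x) (at (x i))"
    "\<forall>i<n. Ck_on k n U (g' i)" using Ck_on_SucE[OF Suc.prems(2)] by blast
  show ?case
  proof (rule Ck_on_SucI[where g = "\<lambda>i x. f' i x + g' i x"])
    show "continuous_on U (\<lambda>x. f x + g x)"
      using Suc.prems by (intro continuous_on_add Ck_on_imp_continuous_on[of "Suc k"])
    show "((\<lambda>t. f (x(i := t)) + g (x(i := t))) has_real_derivative f' i x + g' i x) (at (x i))"
      if "i < n" "x \<in> U" for i x
      by (rule DERIV_add[OF f'(1)[rule_format, OF that] g'(1)[rule_format, OF that]])
    show "Ck_on k n U (\<lambda>x. f' i x + g' i x)" if "i < n" for i
      by (rule Suc.IH[OF f'(2)[rule_format, OF that] g'(2)[rule_format, OF that]])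
  qed
qed

lemma Ck_on_mult: "Ck_on k n U f \<Longrightarrow> Ck_on k n U g \<Longrightarrow> Ck_on k n U (\<lambda>x. f x * g x)"
proof (induction k arbitrary: f g)
  case 0
  then show ?case by (auto intro: continuous_intros)
next
  case (Suc k)
  obtain f' where f': "\<forall>i<n. \<forall>x\<in>U. ((\<lambda>t. f (x(i := t))) has_real_derivative f' i x) (at (x i))"
    "\<forall>i<n. Ck_on k n U (f' i)" using Ck_on_SucE[OF Suc.prems(1)] by blast
  obtain g' where g': "\<forall>i<n. \<forall>x\<in>U. ((\<lambda>t. g (x(i := t))) has_real_derivative g' i x) (at (x i))"
    "\<forall>i<n. Ck_on k n U (g' i)" using Ck_on_SucE[OF Suc.prems(2)] by blast
  show ?case
  proof (rule Ck_on_SucI[where g = "\<lambda>i x. f x * g' i x + f' i x * g x"])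
    show "continuous_on U (\<lambda>x. f x * g x)"
      using Suc.prems by (intro continuous_on_mult Ck_on_imp_continuous_on[of "Suc k"])
    show "((\<lambda>t. f (x(i := t)) * g (x(i := t))) has_real_derivative f x * g' i x + f' i x * g x) (at (x i))"
      if "i < n" "x \<in> U" for i x
      using DERIV_mult'[OF f'(1)[rule_format, OF that] g'(1)[rule_format, OF that]] by simp
    show "Ck_on k n U (\<lambda>x. f x * g' i x + f' i x * g x)" if "i < n" for i
      using f'(2)[rule_format, OF that] g'(2)[rule_format, OF that] Suc.prems[THEN Ck_on_SucD]
      by (intro Ck_on_add Suc.IH)
  qed
qed

text \<open>For an outer function of one variable only the first derivative appears, and its
  composite with f is assumed to be one order less smooth. This suits \<open>inverse\<close>,
  \<open>exp\<close> and \<open>ln\<close>, whose derivatives are built from functions already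
  treated or from the induction hypothesis.\<close>

lemma Ck_on_chain:
  assumes f: "Ck_on (Suc k) n U f"
    and h: "\<And>x. x \<in> U \<Longrightarrow> (h has_real_derivative h' (f x)) (at (f x))"
    and h': "Ck_on k n U (\<lambda>x. h' (f x))"
  shows "Ck_on (Suc k) n U (\<lambda>x. h (f x))"
proof -
  obtain f' where f': "\<forall>i<n. \<forall>x\<in>U. ((\<lambda>t. f (x(i := t))) has_real_derivative f' i x) (at (x i))"
    "\<forall>i<n. Ck_on k n U (f' i)" using Ck_on_SucE[OF f] by blast
  show ?thesis
  proof (rule Ck_on_SucI[where g = "\<lambda>i x. h' (f x) * f' i x"])
    have "continuous_on (f ` U) h"
      using DERIV_isCont[OF h] by (intro continuous_at_imp_continuous_on) blast
    then show "continuous_on U (\<lambda>x. h (f x))"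
      using Ck_on_imp_continuous_on[OF f] by (rule continuous_on_compose2) simp
    show "((\<lambda>t. h (f (x(i := t)))) has_real_derivative h' (f x) * f' i x) (at (x i))"
      if "i < n" "x \<in> U" for i x
      using DERIV_chain2[OF _ f'(1)[rule_format, OF that], of h "h' (f x)"] h that by simp
  qed (intro Ck_on_mult h' f'(2)[rule_format])
qed

lemma Ck_on_uminus: "Ck_on k n U f \<Longrightarrow> Ck_on k n U (\<lambda>x. - f x)"
  using Ck_on_mult[OF Ck_on_const[of k n U "-1"], of f] by simp

lemma Ck_on_diff: "Ck_on k n U f \<Longrightarrow> Ck_on k n U g \<Longrightarrow> Ck_on k n U (\<lambda>x. f x - g x)"
  using Ck_on_add[of k n U f "\<lambda>x. - g x"] Ck_on_uminus[of k n U g] by simp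

lemma Ck_on_inverse:
  "Ck_on k n U f \<Longrightarrow> (\<And>x. x \<in> U \<Longrightarrow> f x \<noteq> 0) \<Longrightarrow> Ck_on k n U (\<lambda>x. inverse (f x))"
proof (induction k)
  case 0
  then show ?case by (auto intro!: continuous_on_inverse)
next
  case (Suc k)
  show ?case
  proof (rule Ck_on_chain[where h = inverse and f = f and h' = "\<lambda>y. - (inverse y * inverse y)"])
    show "(inverse has_real_derivative - (inverse (f x) * inverse (f x))) (at (f x))" if "x \<in> U" for x
      using DERIV_inverse[of "f x" UNIV] Suc.prems(2)[OF that] by (simp add: power2_eq_square)
    show "Ck_on k n U (\<lambda>x. - (inverse (f x) * inverse (f x)))"
      using Suc.IH[OF Ck_on_SucD[OF Suc.prems(1)] Suc.prems(2)]
      by (intro Ck_on_uminus Ck_on_mult)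
  qed (fact Suc.prems)
qed

lemma Ck_on_divide:
  "Ck_on k n U f \<Longrightarrow> Ck_on k n U g \<Longrightarrow> (\<And>x. x \<in> U \<Longrightarrow> g x \<noteq> 0) \<Longrightarrow> Ck_on k n U (\<lambda>x. f x / g x)"
  unfolding divide_inverse by (intro Ck_on_mult Ck_on_inverse)

lemma Ck_on_exp: "Ck_on k n U f \<Longrightarrow> Ck_on k n U (\<lambda>x. exp (f x))"
proof (induction k)
  case 0
  then show ?case by (auto intro!: continuous_on_exp)
next
  case (Suc k)
  show ?case
    by (rule Ck_on_chain[where h = exp and f = f and h' = exp, OF Suc.prems DERIV_exp
          Suc.IH[OF Ck_on_SucD[OF Suc.prems]]])
qed

lemma Ck_on_ln:
  "Ck_on k n U f \<Longrightarrow> (\<And>x. x \<in> U \<Longrightarrow> 0 < f x) \<Longrightarrow> Ck_on k n U (\<lambda>x. ln (f x))"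
proof (cases k)
  case 0
  assume "Ck_on k n U f" "\<And>x. x \<in> U \<Longrightarrow> 0 < f x"
  with 0 show ?thesis by (force intro!: continuous_on_ln)
next
  case (Suc m)
  assume f: "Ck_on k n U f" and pos: "\<And>x. x \<in> U \<Longrightarrow> 0 < f x"
  have "Ck_on (Suc m) n U (\<lambda>x. ln (f x))"
  proof (rule Ck_on_chain[where h = ln and f = f and h' = inverse])
    show "(ln has_real_derivative inverse (f x)) (at (f x))" if "x \<in> U" for x
      using DERIV_ln[OF pos[OF that]] .
    show "Ck_on m n U (\<lambda>x. inverse (f x))"
      using pos by (intro Ck_on_inverse Ck_on_SucD[OF f[unfolded Suc]]) (simp add: less_imp_neq[symmetric])
  qed (use f Suc in simp)
  then show ?thesis using Suc by simp
qed

lemma Ck_on_sum: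
  assumes "\<And>a. a \<in> A \<Longrightarrow> Ck_on k n U (f a)"
  shows "Ck_on k n U (\<lambda>x. \<Sum>a\<in>A. f a x)"
proof (cases "finite A")
  case True
  then show ?thesis using assms
    by (induction A) (auto intro: Ck_on_const Ck_on_add)
qed (simp add: Ck_on_const)

lemma Ck_on_If:
  "(P \<Longrightarrow> Ck_on k n U f) \<Longrightarrow> (\<not> P \<Longrightarrow> Ck_on k n U g) \<Longrightarrow> Ck_on k n U (\<lambda>x. if P then f x else g x)"
  by (cases P) simp_all

lemmas Ck_on_intros = Ck_on_const Ck_on_proj Ck_on_add Ck_on_diff Ck_on_mult Ck_on_divide Ck_on_exp Ck_on_ln
  Ck_on_sum Ck_on_If

section \<open>Affine charts of the open simplex\<close>

lemma openin_Collect_less: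
  assumes "continuous_map X euclideanreal f" "continuous_map X euclideanreal g"
  shows "openin X {x \<in> topspace X. f x < g x}"
proof -
  have "openin X {x \<in> topspace X. g x - f x \<in> {0<..}}"
    by (rule openin_continuous_map_preimage[OF continuous_map_diff[OF assms(2,1)]]) auto
  then show ?thesis by simp
qed

lemma openin_Collect_ball:
  assumes "finite A" "\<And>a. a \<in> A \<Longrightarrow> openin X {x \<in> topspace X. P a x}"
  shows "openin X {x \<in> topspace X. \<forall>a\<in>A. P a x}"
  using assms
proof (induction A)
  case (insert a A)
  have "{x \<in> topspace X. \<forall>a\<in>insert a A. P a x} =
      {x \<in> topspace X. P a x} \<inter> {x \<in> topspace X. \<forall>a\<in>A. P a x}" by auto
  then show ?case using insert by (simp add: openin_Int)
qed simp

lemma continuous_map_Euclidean_coord: "continuous_map (Euclidean_space n) euclideanreal (\<lambda>u. u i)"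
  by (auto simp: Euclidean_space_eq_top_of_set
      intro: continuous_on_product_then_coordinatewise continuous_on_id)

lemma second_countable_euclidean: "second_countable (euclidean :: 'a::second_countable_topology topology)"
proof -
  obtain B :: "'a set set" where B: "countable B" "topological_basis B"
    using ex_countable_basis by blast
  then show ?thesis
    unfolding second_countable_def
  proof (intro exI[of _ B] conjI allI impI ballI)
    show "openin euclidean V" if "V \<in> B" for V
      using topological_basis_open[OF B(2) that] by simp
    show "\<exists>V\<in>B. x \<in> V \<and> V \<subseteq> U" if U: "openin euclidean U \<and> x \<in> U" for U x
    proof -
      obtain V where "V \<in> B" "x \<in> V" "V \<subseteq> U"
        using topological_basisE[OF B(2), of U x] U by auto
      then show ?thesis by blast
    qed
  qed
qed

lemma continuous_map_vec_lambda:
  fixes F :: "'a \<Rightarrow> 'e::finite \<Rightarrow> 'b::real_normed_vector"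
  assumes "\<And>e. continuous_map X euclidean (\<lambda>u. F u e)"
  shows "continuous_map X euclidean (\<lambda>u. \<chi> e. F u e)"
  using assms unfolding continuous_map_atin limitin_canonical_iff
  by (auto intro!: tendsto_vec_lambda)


section \<open>Homogeneous coordinates and their ratios\<close>

lemma proj_pt_self: "z \<in> proj_pt z"
  unfolding proj_pt_def by (rule CollectI, rule exI[of _ 1]) simp

lemma proj_pt_scale:
  assumes "c \<noteq> 0"
  shows "proj_pt (c *s z) = proj_pt z"
proof -
  have "d *s (c *s z) = (d * c) *s z" "d *s z = (d / c) *s (c *s z)" for d
    using assms by simp_all
  then show ?thesis
    using assms unfolding proj_pt_def by (smt (verit) Collect_cong divide_eq_0_iff mult_eq_0_iff)
qed

text \<open>The representative picked by \<open>SOME\<close> is a nonzero multiple of z, and the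
  scalar cancels in the quotient.\<close>

lemma ratio_proj_pt: "ratio (proj_pt z) f e = Re (z $ f / z $ e)"
proof -
  have "(SOME w. w \<in> proj_pt z) \<in> proj_pt z"
    using proj_pt_self by (rule someI)
  then obtain c where "(SOME w. w \<in> proj_pt z) = c *s z" "c \<noteq> 0"
    unfolding proj_pt_def by blast
  then show ?thesis by (simp add: ratio_def)
qed

lemma ratio_hom_pt: "ratio (hom_pt x) f e = x $ f / x $ e"
  by (simp add: hom_pt_def ratio_proj_pt flip: of_real_divide)

lemma hom_pt_scale:
  assumes "c \<noteq> 0"
  shows "hom_pt (c *s x) = hom_pt x"
proof -
  have "(\<chi> e. complex_of_real ((c *s x) $ e)) = complex_of_real c *s (\<chi> e. complex_of_real (x $ e))"
    by (simp add: vec_eq_iff)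
  then have "hom_pt (c *s x) = proj_pt (complex_of_real c *s (\<chi> e. complex_of_real (x $ e)))"
    by (simp only: hom_pt_def)
  also have "\<dots> = hom_pt x"
    unfolding hom_pt_def by (rule proj_pt_scale) (use assms in simp)
  finally show ?thesis .
qed

text \<open>The ratios with denominator e are the representative with coordinate 1 at e. Points of
  the simplex can thus be handled through their ratios alone.\<close>

lemma hom_pt_ratio:
  assumes "q \<in> open_simplex"
  shows "hom_pt (\<chi> f. ratio q f e) = q" and "0 < ratio q f e"
proof -
  obtain x where x: "q = hom_pt x" "\<forall>e. 0 < x $ e"
    using assms by (auto simp: open_simplex_def)
  have "(\<chi> f. ratio q f e) = (1 / x $ e) *s x"
    by (simp add: vec_eq_iff x ratio_hom_pt)
  then show "hom_pt (\<chi> f. ratio q f e) = q"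
    using hom_pt_scale[of "1 / x $ e" x] x by (simp add: less_imp_neq[symmetric])
  show "0 < ratio q f e" by (simp add: x ratio_hom_pt)
qed

lemma ratio_trans: "q \<in> open_simplex \<Longrightarrow> ratio q f e = ratio q f g / ratio q e g"
  by (metis hom_pt_ratio(1) ratio_hom_pt vec_lambda_beta)

lemma hom_pt_in_open_simplex: "(\<And>e. 0 < x $ e) \<Longrightarrow> hom_pt x \<in> open_simplex"
  by (auto simp: open_simplex_def)

text \<open>Normalizing at any one s off T makes all coordinates off T equal to 1, so the conditions
  on pairs of coordinates become conditions on single ratios.\<close>

lemma cube_iff:
  assumes "s \<notin> T"
  shows "q \<in> cube T \<longleftrightarrow> q \<in> open_simplex \<and> (\<forall>t. t \<notin> T \<longrightarrow> ratio q t s = 1) \<and> (\<forall>i\<in>T. ratio q i s < 1)"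
proof
  assume "q \<in> cube T"
  then obtain x where x: "q = hom_pt x" "\<forall>e. 0 < x $ e" "\<forall>i\<in>T. \<forall>j\<in>-T. x $ i < x $ j"
    "\<forall>i\<in>-T. \<forall>j\<in>-T. x $ i = x $ j"
    unfolding cube_def mem_Collect_eq by (elim exE conjE) (rule that)
  then show "q \<in> open_simplex \<and> (\<forall>t. t \<notin> T \<longrightarrow> ratio q t s = 1) \<and> (\<forall>i\<in>T. ratio q i s < 1)"
  proof (intro conjI allI impI ballI)
    show "q \<in> open_simplex" unfolding x(1) using x(2) by (intro hom_pt_in_open_simplex) simp
    show "ratio q t s = 1" if "t \<notin> T" for t
    proof -
      have "x $ t = x $ s" using x(4) that assms by (metis ComplI)
      moreover have "x $ s \<noteq> 0" using x(2) by (metis less_irrefl)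
      ultimately show ?thesis unfolding x(1) ratio_hom_pt by simp
    qed
    show "ratio q i s < 1" if "i \<in> T" for i
    proof -
      have "x $ i < x $ s" "0 < x $ s" using x(2,3) that assms by (metis ComplI)+
      then show ?thesis unfolding x(1) ratio_hom_pt by simp
    qed
  qed
next
  assume *: "q \<in> open_simplex \<and> (\<forall>t. t \<notin> T \<longrightarrow> ratio q t s = 1) \<and> (\<forall>i\<in>T. ratio q i s < 1)"
  then have q: "q \<in> open_simplex" by blast
  show "q \<in> cube T"
    unfolding cube_def
  proof (intro CollectI exI[of _ "\<chi> f. ratio q f s"] conjI)
    show "q = hom_pt (\<chi> f. ratio q f s)" using hom_pt_ratio(1)[OF q] by (rule sym)
    show "\<forall>e. 0 < (\<chi> f. ratio q f s) $ e" using hom_pt_ratio(2)[OF q] by simp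
  qed (use * in simp_all)
qed

lemma topspace_proj_topology: "topspace (proj_topology :: (complex ^ 'e::finite) set topology) = proj_space"
proof
  have "{z :: complex ^ 'e. z \<noteq> 0 \<and> proj_pt z \<in> proj_space} = - {0}"
    by (auto simp: proj_space_def)
  then have "openin proj_topology (proj_space :: (complex ^ 'e) set set)"
    by (simp add: openin_proj_topology open_Compl)
  then show "proj_space \<subseteq> topspace (proj_topology :: (complex ^ 'e) set topology)"
    by (rule openin_subset)
  show "topspace (proj_topology :: (complex ^ 'e) set topology) \<subseteq> proj_space"
    using openin_topspace[of "proj_topology :: (complex ^ 'e) set topology",
        unfolded openin_proj_topology] by (rule conjunct1)
qed

lemma open_simplex_subset_proj_space: "open_simplex \<subseteq> proj_space"
proof
  fix q :: "(complex ^ 'a) set" assume "q \<in> open_simplex"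
  then obtain x where x: "q = hom_pt x" "\<forall>e. 0 < x $ e"
    by (auto simp: open_simplex_def)
  then have "(\<chi> e. complex_of_real (x $ e)) \<noteq> 0"
    by (auto simp: vec_eq_iff less_imp_neq[symmetric])
  then show "q \<in> proj_space" using x by (auto simp: proj_space_def hom_pt_def)
qed

lemma topspace_sub_simplex:
  "X \<subseteq> open_simplex \<Longrightarrow> topspace (subtopology proj_topology X) = X"
  using open_simplex_subset_proj_space by (auto simp: topspace_proj_topology)

lemma continuous_map_ratio:
  assumes "X \<subseteq> open_simplex"
  shows "continuous_map (subtopology proj_topology X) euclideanreal (\<lambda>q. ratio q f e)"
proof -
  \<comment> \<open>The ratio is continuous on the whole open set of complex projective space where
    coordinate e does not vanish; openness there can be tested on representatives by the quotient
    topology.\<close>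
  define N where "N = {q \<in> proj_space. \<exists>z. q = proj_pt z \<and> z $ e \<noteq> 0}"
  have N: "z $ e \<noteq> 0" if "proj_pt z \<in> N" for z
  proof -
    obtain w where "proj_pt z = proj_pt w" "w $ e \<noteq> 0" using \<open>proj_pt z \<in> N\<close> by (auto simp: N_def)
    then obtain c where "w = c *s z" using proj_pt_self[of w] by (auto simp: proj_pt_def)
    then show ?thesis using \<open>w $ e \<noteq> 0\<close> by auto
  qed
  have "openin (subtopology proj_topology X) {q \<in> X. ratio q f e \<in> W}" if W: "open W" for W
  proof -
    define S where "S = {q \<in> N. ratio q f e \<in> W}"
    have "{z. z \<noteq> 0 \<and> proj_pt z \<in> S} = {z. z $ e \<noteq> 0} \<inter> (\<lambda>z. Re (z $ f / z $ e)) -` W" (is "?L = ?R")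
    proof (intro equalityI subsetI)
      fix z assume z: "z \<in> ?R"
      then have "z \<noteq> 0" by auto
      moreover have "proj_pt z \<in> N"
        using z \<open>z \<noteq> 0\<close> unfolding N_def proj_space_def by blast
      ultimately show "z \<in> ?L"
        using z by (simp add: S_def ratio_proj_pt)
    next
      fix z assume "z \<in> ?L"
      then show "z \<in> ?R" using N[of z] by (simp add: S_def ratio_proj_pt)
    qed
    moreover have "open ({z. z $ e \<noteq> 0} \<inter> (\<lambda>z. Re (z $ f / z $ e)) -` W)"
      by (rule continuous_open_preimage)
        (auto intro!: continuous_intros open_Collect_neq W)
    ultimately have "openin proj_topology S"
      by (auto simp: openin_proj_topology S_def N_def)
    moreover have "{q \<in> X. ratio q f e \<in> W} = S \<inter> X"
    proof -
      have "X \<subseteq> N"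
      proof
        fix q assume "q \<in> X"
        then have "q \<in> open_simplex" using assms by blast
        then obtain x where "q = hom_pt x" "\<forall>e. 0 < x $ e"
          unfolding open_simplex_def by blast
        moreover have "(\<chi> e. complex_of_real (x $ e)) $ e \<noteq> 0"
          using calculation(2) by (simp add: less_imp_neq[symmetric])
        ultimately show "q \<in> N" using open_simplex_subset_proj_space \<open>q \<in> open_simplex\<close>
          unfolding N_def hom_pt_def by blast
      qed
      then show ?thesis by (auto simp: S_def)
    qed
    ultimately show ?thesis by (auto simp: openin_subtopology)
  qed
  then show ?thesis
    unfolding continuous_map_def topspace_sub_simplex[OF assms] by simp
qed

text \<open>Positivity keeps the vector of coordinates away from 0, so the map factors through the
  nonzero vectors and the quotient projection.\<close>

lemma continuous_map_hom_pt:
  fixes F :: "'a \<Rightarrow> 'e::finite \<Rightarrow> real"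
  assumes F: "\<And>e. continuous_map X euclideanreal (\<lambda>u. F u e)"
    and pos: "\<And>u e. u \<in> topspace X \<Longrightarrow> 0 < F u e"
  shows "continuous_map X (subtopology proj_topology open_simplex) (\<lambda>u. hom_pt (\<chi> e. F u e))"
proof -
  let ?z = "\<lambda>u. \<chi> e. complex_of_real (F u e)"
  have z: "continuous_map X euclidean ?z"
  proof (rule continuous_map_vec_lambda)
    show "continuous_map X euclidean (\<lambda>u. complex_of_real (F u e))" for e
      using F unfolding continuous_map_atin limitin_canonical_iff by (auto intro!: tendsto_of_real)
  qed
  have "openin X {u \<in> topspace X. hom_pt (\<chi> e. F u e) \<in> S}" if S: "openin proj_topology S" for S
  proof -
    have "openin X {u \<in> topspace X. ?z u \<in> {z. z \<noteq> 0 \<and> proj_pt z \<in> S}}"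
      by (rule openin_continuous_map_preimage[OF z]) (use S in \<open>simp add: openin_proj_topology\<close>)
    moreover have "?z u \<noteq> 0" if "u \<in> topspace X" for u
      using pos[OF that] by (auto simp: vec_eq_iff less_imp_neq[symmetric])
    then have "{u \<in> topspace X. ?z u \<in> {z. z \<noteq> 0 \<and> proj_pt z \<in> S}} =
        {u \<in> topspace X. hom_pt (\<chi> e. F u e) \<in> S}"
      by (auto simp: hom_pt_def)
    ultimately show ?thesis by simp
  qed
  moreover have pos_pt: "hom_pt (\<chi> e. F u e) \<in> open_simplex" if "u \<in> topspace X" for u
    using pos[OF that] by (intro hom_pt_in_open_simplex) simp
  ultimately have "continuous_map X proj_topology (\<lambda>u. hom_pt (\<chi> e. F u e))"
    using open_simplex_subset_proj_space by (auto simp: continuous_map_def topspace_proj_topology)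
  then show ?thesis
    using pos_pt by (auto simp: continuous_map_in_subtopology)
qed

section \<open>Affine charts and their explicit inverses\<close>

definition positive_orthant :: "nat \<Rightarrow> (nat \<Rightarrow> real) set" where
  "positive_orthant n = {u \<in> topspace (Euclidean_space n). \<forall>i\<in>{..<n}. 0 < u i}"

text \<open>Giving the value 1 to every coordinate not enumerated by b covers both cases at once: in
  the simplex only the normalized coordinate is left over, in the cube all coordinates off T
  are.\<close>

definition chart_vec :: "nat \<Rightarrow> (nat \<Rightarrow> 'e) \<Rightarrow> (nat \<Rightarrow> real) \<Rightarrow> 'e \<Rightarrow> real" where
  "chart_vec n b u f = (if f \<in> b ` {..<n} then u (inv_into {..<n} b f) else 1)"

definition chart_pt :: "nat \<Rightarrow> (nat \<Rightarrow> 'e) \<Rightarrow> (nat \<Rightarrow> real) \<Rightarrow> (complex ^ 'e) set" where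
  "chart_pt n b u = hom_pt (\<chi> f. chart_vec n b u f)"

text \<open>The common features of the charts of the simplex and of the cube: on X the coordinates
  not listed by b all agree with the normalized one.\<close>

definition affine_chart :: "nat \<Rightarrow> (nat \<Rightarrow> 'e) \<Rightarrow> 'e \<Rightarrow> (complex ^ 'e) set set \<Rightarrow> bool" where
  "affine_chart n b e X \<longleftrightarrow> X \<subseteq> open_simplex \<and> inj_on b {..<n} \<and> e \<notin> b ` {..<n} \<and>
     (\<forall>q\<in>X. \<forall>f. f \<notin> b ` {..<n} \<longrightarrow> ratio q f e = 1)"

lemma affine_chart_subset: "affine_chart n b e X \<Longrightarrow> Y \<subseteq> X \<Longrightarrow> affine_chart n b e Y"
  by (auto simp: affine_chart_def)

lemma openin_positive_orthant: "openin (Euclidean_space n) (positive_orthant n)"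
  unfolding positive_orthant_def
  by (intro openin_Collect_ball openin_Collect_less continuous_map_Euclidean_coord) auto

lemma chart_vec_pos: "u \<in> positive_orthant n \<Longrightarrow> 0 < chart_vec n b u f"
  using inv_into_into[of f b "{..<n}"] by (auto simp: chart_vec_def positive_orthant_def)

lemma chart_vec_nth: "inj_on b {..<n} \<Longrightarrow> i < n \<Longrightarrow> chart_vec n b u (b i) = u i"
  by (simp add: chart_vec_def)

lemma Ck_on_chart_vec: "Ck_on k m U (\<lambda>u. chart_vec n b u f)"
  unfolding chart_vec_def by (intro Ck_on_intros)

lemma ratio_chart_pt: "ratio (chart_pt n b u) f e = chart_vec n b u f / chart_vec n b u e"
  by (simp add: chart_pt_def ratio_hom_pt)

lemma chart_pt_in_open_simplex: "u \<in> positive_orthant n \<Longrightarrow> chart_pt n b u \<in> open_simplex"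
  unfolding chart_pt_def by (intro hom_pt_in_open_simplex) (simp add: chart_vec_pos)

lemma affine_coords_chart_pt:
  assumes "inj_on b {..<n}" "e \<notin> b ` {..<n}" "u \<in> positive_orthant n"
  shows "affine_coords n b e (chart_pt n b u) = u"
  using assms
  by (auto simp: affine_coords_def ratio_chart_pt chart_vec_nth fun_eq_iff positive_orthant_def
      topspace_Euclidean_space) (simp add: chart_vec_def)

lemma affine_coords_in_orthant:
  "q \<in> open_simplex \<Longrightarrow> affine_coords n b e q \<in> positive_orthant n"
  by (simp add: positive_orthant_def affine_coords_def topspace_Euclidean_space hom_pt_ratio)

lemma chart_pt_affine_coords:
  assumes "affine_chart n b e X" "q \<in> X"
  shows "chart_pt n b (affine_coords n b e q) = q"
proof -
  have "chart_vec n b (affine_coords n b e q) f = ratio q f e" for f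
  proof (cases "f \<in> b ` {..<n}")
    case True
    then have "inv_into {..<n} b f < n" "b (inv_into {..<n} b f) = f"
      using inv_into_into[of f b "{..<n}"] f_inv_into_f[of f b "{..<n}"] by auto
    then show ?thesis using True by (simp add: chart_vec_def affine_coords_def)
  qed (use assms in \<open>auto simp: chart_vec_def affine_chart_def\<close>)
  moreover have "q \<in> open_simplex" using assms by (auto simp: affine_chart_def)
  ultimately show ?thesis using hom_pt_ratio(1)[of q e] by (simp add: chart_pt_def)
qed

lemma affine_coords_image:
  assumes "affine_chart n b e X"
  shows "affine_coords n b e ` X = {u \<in> positive_orthant n. chart_pt n b u \<in> X}"
proof (intro equalityI subsetI)
  fix u assume "u \<in> affine_coords n b e ` X"
  then show "u \<in> {u \<in> positive_orthant n. chart_pt n b u \<in> X}"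
    using assms chart_pt_affine_coords[OF assms]
    by (auto simp: affine_chart_def intro!: affine_coords_in_orthant)
next
  fix u assume "u \<in> {u \<in> positive_orthant n. chart_pt n b u \<in> X}"
  then show "u \<in> affine_coords n b e ` X"
    using assms affine_coords_chart_pt[of b n e u] by (auto simp: affine_chart_def intro: rev_image_eqI)
qed

text \<open>Smoothness is stated with \<open>inv_into\<close>; this turns it into the formula
  \<open>chart_pt\<close>, whose coordinates are quotients of entries of u and 1.\<close>

lemma inv_into_affine_coords:
  assumes "affine_chart n b e X" "u \<in> affine_coords n b e ` X"
  shows "inv_into X (affine_coords n b e) u = chart_pt n b u"
proof (rule inv_into_f_eq)
  show "inj_on (affine_coords n b e) X"
    by (rule inj_on_inverseI[of _ "chart_pt n b"]) (rule chart_pt_affine_coords[OF assms(1)])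
  show "chart_pt n b u \<in> X" "affine_coords n b e (chart_pt n b u) = u"
    using assms by (auto simp: affine_coords_image affine_coords_chart_pt affine_chart_def)
qed

lemma continuous_map_chart_pt:
  "continuous_map (subtopology (Euclidean_space n) (positive_orthant n))
     (subtopology proj_topology open_simplex) (chart_pt n b)"
proof -
  have "continuous_map (Euclidean_space n) euclideanreal (\<lambda>u. chart_vec n b u f)" for f
    unfolding chart_vec_def using continuous_map_Euclidean_coord
    by (cases "f \<in> b ` {..<n}") simp_all
  then show ?thesis
    unfolding chart_pt_def
    by (intro continuous_map_hom_pt continuous_map_from_subtopology chart_vec_pos) auto
qed

lemma continuous_map_affine_coords:
  assumes "X \<subseteq> open_simplex"
  shows "continuous_map (subtopology proj_topology X) (Euclidean_space n) (affine_coords n b e)"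
  unfolding affine_coords_def
  using continuous_map_ratio[OF assms] by (simp add: continuous_map_componentwise_Euclidean_space)

text \<open>The image is the preimage of V under the continuous inverse \<open>chart_pt\<close>,
  taken inside the open orthant.\<close>

lemma openin_affine_coords_image:
  assumes "affine_chart n b e open_simplex" "openin (subtopology proj_topology open_simplex) V"
  shows "openin (Euclidean_space n) (affine_coords n b e ` V)"
proof -
  have V: "V \<subseteq> open_simplex"
    using openin_subset[OF assms(2)] by (simp add: topspace_sub_simplex)
  let ?Q = "subtopology (Euclidean_space n) (positive_orthant n)"
  have top: "topspace ?Q = positive_orthant n"
    by (auto simp: positive_orthant_def)
  have "openin ?Q {u \<in> topspace ?Q. chart_pt n b u \<in> V}"
    by (rule openin_continuous_map_preimage[OF continuous_map_chart_pt assms(2)])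
  then have "openin (Euclidean_space n) {u \<in> positive_orthant n. chart_pt n b u \<in> V}"
    unfolding top by (rule openin_trans_full[OF _ openin_positive_orthant])
  then show ?thesis
    using affine_coords_image[OF affine_chart_subset[OF assms(1) V]] by simp
qed

lemma homeomorphic_map_affine_coords:
  assumes "affine_chart n b e X"
  shows "homeomorphic_map (subtopology proj_topology X)
     (subtopology (Euclidean_space n) (affine_coords n b e ` X)) (affine_coords n b e)"
proof -
  have X: "X \<subseteq> open_simplex" using assms by (simp add: affine_chart_def)
  have im: "affine_coords n b e ` X \<subseteq> positive_orthant n"
    using affine_coords_image[OF assms] by auto
  have sub: "subtopology (Euclidean_space n) (affine_coords n b e ` X) =
      subtopology (subtopology (Euclidean_space n) (positive_orthant n)) (affine_coords n b e ` X)"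
    using im by (simp add: subtopology_subtopology Int_absorb1)
  have "homeomorphic_maps (subtopology proj_topology X)
     (subtopology (Euclidean_space n) (affine_coords n b e ` X)) (affine_coords n b e) (chart_pt n b)"
    unfolding homeomorphic_maps_def
  proof (intro conjI)
    show "continuous_map (subtopology proj_topology X)
        (subtopology (Euclidean_space n) (affine_coords n b e ` X)) (affine_coords n b e)"
      using continuous_map_affine_coords[OF X]
      by (auto simp: continuous_map_in_subtopology topspace_sub_simplex[OF X])
    have "continuous_map (subtopology (Euclidean_space n) (affine_coords n b e ` X))
        proj_topology (chart_pt n b)"
      unfolding sub using continuous_map_chart_pt[of n b]
      by (auto simp: continuous_map_in_subtopology intro: continuous_map_from_subtopology)
    then show "continuous_map (subtopology (Euclidean_space n) (affine_coords n b e ` X))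
        (subtopology proj_topology X) (chart_pt n b)"
      using chart_pt_affine_coords[OF assms] by (auto simp: continuous_map_in_subtopology)
  qed (use chart_pt_affine_coords[OF assms] in \<open>auto simp: topspace_sub_simplex[OF X]\<close>)
  then show ?thesis using homeomorphic_map_maps by blast
qed

text \<open>Every chart has the full domain X, so the Hausdorff property and second countability are
  transported from the image of a single chart, and every transition function is a quotient of two
  entries of \<open>chart_vec\<close>.\<close>

lemma smooth_manifold_affine:
  assumes X: "X \<subseteq> open_simplex" and ne: "A \<noteq> {}"
    and A: "\<And>U \<phi>. (U, \<phi>) \<in> A \<Longrightarrow> U = X \<and> (\<exists>b e. \<phi> = affine_coords n b e \<and> affine_chart n b e X \<and>
      openin (Euclidean_space n) (affine_coords n b e ` X))"
  shows "smooth_manifold \<lparr>mtop = subtopology proj_topology X, mdim = n, atlas = A\<rparr>"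
proof -
  obtain U \<phi> where "(U, \<phi>) \<in> A" using ne by auto
  then obtain b e where be: "affine_chart n b e X" using A[OF \<open>(U, \<phi>) \<in> A\<close>] by blast
  have hom: "subtopology proj_topology X homeomorphic_space
     subtopology (Euclidean_space n) (affine_coords n b e ` X)"
    using homeomorphic_map_affine_coords[OF be] homeomorphic_map_imp_homeomorphic_space by blast
  have un: "(\<Union>(U, \<phi>)\<in>A. U) = X"
  proof -
    have "(case a of (U, \<phi>) \<Rightarrow> U) = X" if "a \<in> A" for a
      using A[of "fst a" "snd a"] that by (simp add: case_prod_beta)
    then have "(\<Union>a\<in>A. case a of (U, \<phi>) \<Rightarrow> U) = (\<Union>a\<in>A. X)" by (rule SUP_cong[OF refl])
    then show ?thesis using ne by simp
  qed
  have smooth: "smooth_on n n (affine_coords n b e ` (X \<inter> X))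
      (affine_coords n b' e' \<circ> inv_into X (affine_coords n b e))"
    if be: "affine_chart n b e X" "openin (Euclidean_space n) (affine_coords n b e ` X)"
    for b e b' e'
    unfolding smooth_on_def
  proof (intro allI impI)
    fix j k assume j: "j < n"
    let ?U = "affine_coords n b e ` (X \<inter> X)"
    have "Ck_on k n ?U (\<lambda>u. chart_vec n b u (b' j) / chart_vec n b u e')"
    proof (intro Ck_on_divide Ck_on_chart_vec)
      fix u assume "u \<in> ?U"
      then have "u \<in> positive_orthant n" unfolding Int_absorb affine_coords_image[OF be(1)] by blast
      then show "chart_vec n b u e' \<noteq> 0" using chart_vec_pos[of u n b e'] by simp
    qed
    then show "Ck_on k n ?U (\<lambda>u. (affine_coords n b' e' \<circ> inv_into X (affine_coords n b e)) u j)"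
      by (rule Ck_on_cong_open[rotated 2])
        (use be j in \<open>simp_all add: inv_into_affine_coords affine_coords_def[of n b'] ratio_chart_pt\<close>)
  qed
  show ?thesis
    unfolding smooth_manifold_def
  proof (simp, intro conjI)
    show "Hausdorff_space (subtopology proj_topology X)"
      unfolding homeomorphic_Hausdorff_space[OF hom]
      by (intro Hausdorff_space_subtopology Hausdorff_Euclidean_space)
    show "second_countable (subtopology proj_topology X)"
      unfolding homeomorphic_space_second_countability[OF hom] Euclidean_space_eq_top_of_set
      by (intro second_countable_subtopology second_countable_euclidean)
    show "(\<Union>(U, \<phi>)\<in>A. U) = topspace proj_topology \<inter> X"
      using un topspace_sub_simplex[OF X] by simp
    show "\<forall>(U, \<phi>)\<in>A. openin (subtopology proj_topology X) U \<and> openin (Euclidean_space n) (\<phi> ` U) \<and>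
        homeomorphic_map (subtopology (subtopology proj_topology X) U)
          (subtopology (Euclidean_space n) (\<phi> ` U)) \<phi>"
    proof clarify
      fix U \<phi> assume "(U, \<phi>) \<in> A"
      then obtain b e where U: "U = X" "\<phi> = affine_coords n b e" "affine_chart n b e X"
        "openin (Euclidean_space n) (affine_coords n b e ` X)" using A[OF \<open>(U, \<phi>) \<in> A\<close>] by blast
      then show "openin (subtopology proj_topology X) U \<and> openin (Euclidean_space n) (\<phi> ` U) \<and>
        homeomorphic_map (subtopology (subtopology proj_topology X) U)
          (subtopology (Euclidean_space n) (\<phi> ` U)) \<phi>"
        using homeomorphic_map_affine_coords[of n b e X]
          openin_topspace[of "subtopology proj_topology X", unfolded topspace_sub_simplex[OF X]]
        by (simp add: subtopology_subtopology)
    qed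
    show "\<forall>(U, \<phi>)\<in>A. \<forall>(V, \<psi>)\<in>A. smooth_on n n (\<phi> ` (U \<inter> V)) (\<psi> \<circ> inv_into U \<phi>)"
    proof clarify
      fix U \<phi> V \<psi> assume *: "(U, \<phi>) \<in> A" "(V, \<psi>) \<in> A"
      obtain b e where "U = X" "\<phi> = affine_coords n b e" "affine_chart n b e X"
        "openin (Euclidean_space n) (affine_coords n b e ` X)" using A[OF *(1)] by blast
      moreover obtain b' e' where "V = X" "\<psi> = affine_coords n b' e'" using A[OF *(2)] by blast
      ultimately show "smooth_on n n (\<phi> ` (U \<inter> V)) (\<psi> \<circ> inv_into U \<phi>)"
        using smooth by simp
    qed
  qed
qed

section \<open>Trivial bundles\<close>

lemma continuous_map_real_iff:
  "continuous_map X euclideanreal f \<longleftrightarrow> (\<forall>x\<in>topspace X. (f \<longlongrightarrow> f x) (atin X x))"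
  by (simp add: continuous_map_atin)

lemma continuous_map_exp:
  assumes "continuous_map X euclideanreal f"
  shows "continuous_map X euclideanreal (\<lambda>x. exp (f x))"
  using assms unfolding continuous_map_real_iff by (simp add: tendsto_exp)

lemma continuous_map_ln:
  assumes "continuous_map X euclideanreal f" "\<And>x. x \<in> topspace X \<Longrightarrow> 0 < f x"
  shows "continuous_map X euclideanreal (\<lambda>x. ln (f x))"
  unfolding continuous_map_real_iff
proof
  fix x assume "x \<in> topspace X"
  then show "((\<lambda>x. ln (f x)) \<longlongrightarrow> ln (f x)) (atin X x)"
    using assms(2)[of x] assms(1) unfolding continuous_map_real_iff by (intro tendsto_ln) auto
qed

lemma open_submanifold_self:
  assumes "topspace (mtop M) \<subseteq> S" "\<And>U \<phi>. (U, \<phi>) \<in> atlas M \<Longrightarrow> U \<subseteq> S"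
  shows "open_submanifold M S = M"
proof -
  have "{(U \<inter> S, \<phi>) | U \<phi>. (U, \<phi>) \<in> atlas M} = atlas M"
  proof (intro equalityI subsetI)
    fix a assume "a \<in> {(U \<inter> S, \<phi>) | U \<phi>. (U, \<phi>) \<in> atlas M}"
    then obtain U \<phi> where a: "a = (U \<inter> S, \<phi>)" "(U, \<phi>) \<in> atlas M" by blast
    then show "a \<in> atlas M" using assms(2)[OF a(2)] by (simp add: Int_absorb2)
  next
    fix a assume a: "a \<in> atlas M"
    obtain U \<phi> where "a = (U, \<phi>)" by (cases a)
    then have "a = (U \<inter> S, \<phi>)" "(U, \<phi>) \<in> atlas M"
      using a assms(2)[of U \<phi>] by (auto simp: Int_absorb2)
    then show "a \<in> {(U \<inter> S, \<phi>) | U \<phi>. (U, \<phi>) \<in> atlas M}" by blast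
  qed
  moreover have "subtopology (mtop M) S = mtop M"
    using assms(1) by (rule subtopology_superset)
  ultimately show ?thesis by (simp add: open_submanifold_def)
qed

lemma smooth_manifold_chart_subset:
  assumes "smooth_manifold M" "(U, \<phi>) \<in> atlas M"
  shows "U \<subseteq> topspace (mtop M)"
proof -
  have "\<forall>(U, \<phi>)\<in>atlas M. openin (mtop M) U \<and> openin (Euclidean_space (mdim M)) (\<phi> ` U) \<and>
        homeomorphic_map (subtopology (mtop M) U)
          (subtopology (Euclidean_space (mdim M)) (\<phi> ` U)) \<phi>"
    using assms(1) unfolding smooth_manifold_def by (elim conjE)
  then have "openin (mtop M) U" using assms(2) by fast
  then show ?thesis by (rule openin_subset)
qed

text \<open>The whole base serves as the trivializing neighbourhood of each point; restricting E and
  B to everything gives back E and B.\<close>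

lemma trivial_smooth_fiber_bundle:
  assumes E: "smooth_manifold E" and B: "smooth_manifold B" and F: "smooth_manifold F"
    and p: "smooth_map E B p" "p ` topspace (mtop E) = topspace (mtop B)"
    and \<Phi>: "diffeomorphism E (prod_manifold B F) \<Phi>" "\<And>q. q \<in> topspace (mtop E) \<Longrightarrow> fst (\<Phi> q) = p q"
  shows "smooth_fiber_bundle E B F p"
proof -
  have "{q \<in> topspace (mtop E). p q \<in> topspace (mtop B)} = topspace (mtop E)"
    using p(2) by blast
  then have "open_submanifold E {q \<in> topspace (mtop E). p q \<in> topspace (mtop B)} = E"
    using open_submanifold_self[OF order_refl smooth_manifold_chart_subset[OF E]] by simp
  moreover have "open_submanifold B (topspace (mtop B)) = B"
    by (rule open_submanifold_self[OF order_refl smooth_manifold_chart_subset[OF B]])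
  ultimately have "\<forall>b\<in>topspace (mtop B). \<exists>U \<phi>. openin (mtop B) U \<and> b \<in> U \<and>
        diffeomorphism (open_submanifold E {p' \<in> topspace (mtop E). p p' \<in> U})
          (prod_manifold (open_submanifold B U) F) \<phi> \<and>
        (\<forall>p'\<in>topspace (mtop E). p p' \<in> U \<longrightarrow> fst (\<phi> p') = p p')"
    using \<Phi> by (intro ballI exI[of _ "topspace (mtop B)"] exI[of _ \<Phi>] conjI) simp_all
  then show ?thesis
    using E B F p unfolding smooth_fiber_bundle_def by (intro conjI)
qed

lemma smooth_manifold_copies_Euclidean: "smooth_manifold (copies k (Euclidean_manifold m))"
proof -
  let ?E = "Euclidean_space m" and ?S = "topspace (Euclidean_space m)"
  let ?X = "prod_topology (discrete_topology {..<k}) ?E"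
  have atlas: "atlas (copies k (Euclidean_manifold m)) = (\<lambda>l. ({l} \<times> ?S, snd)) ` {..<k}"
    by (auto simp: copies_def Euclidean_manifold_def)
  have img: "snd ` ({l} \<times> ?S) = ?S" for l :: nat
    by force
  \<comment> \<open>The usual topology of the natural numbers is discrete, so the product becomes a
    subspace of a second countable topological space.\<close>
  have "discrete_topology {..<k} = top_of_set {..<k}"
  proof -
    have "discrete_topology {..<k} = subtopology (discrete_topology UNIV) {..<k}"
      by (simp add: subtopology_discrete_topology)
    also have "discrete_topology (UNIV :: nat set) = euclidean"
      by (simp add: topology_eq open_discrete)
    finally show ?thesis .
  qed
  then have X: "?X = top_of_set ({..<k} \<times> {x. \<forall>i\<ge>m. x i = 0})"
    by (simp add: Euclidean_space_eq_top_of_set prod_topology_subtopology_eu)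
  have sec: "second_countable ?X"
    unfolding X by (intro second_countable_subtopology second_countable_euclidean)
  have haus: "Hausdorff_space ?X"
    by (simp add: Hausdorff_space_prod_topology Hausdorff_Euclidean_space)
  have chart: "openin ?X ({l} \<times> ?S)"
    "homeomorphic_map (subtopology ?X ({l} \<times> ?S)) (subtopology ?E ?S) snd" if l: "l < k" for l
  proof -
    show "openin ?X ({l} \<times> ?S)"
      using l by (simp add: openin_prod_Times_iff)
    have "homeomorphic_maps (subtopology ?X ({l} \<times> ?S)) ?E snd (Pair l)"
      unfolding homeomorphic_maps_def
    proof (intro conjI)
      show "continuous_map (subtopology ?X ({l} \<times> ?S)) ?E snd"
        by (intro continuous_map_from_subtopology continuous_map_snd)
      show "continuous_map ?E (subtopology ?X ({l} \<times> ?S)) (Pair l)"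
        using l by (auto simp: continuous_map_in_subtopology continuous_map_pairwise o_def)
    qed auto
    then show "homeomorphic_map (subtopology ?X ({l} \<times> ?S)) (subtopology ?E ?S) snd"
      unfolding subtopology_topspace using homeomorphic_map_maps by blast
  qed
  have smooth: "smooth_on m m (snd ` ({l} \<times> ?S \<inter> {l'} \<times> ?S)) (snd \<circ> inv_into ({l} \<times> ?S) snd)"
    for l l' :: nat
  proof (cases "l = l'")
    case True
    then have "{l} \<times> ?S \<inter> {l'} \<times> ?S = {l} \<times> ?S" by blast
    moreover have "Ck_on i m ?S (\<lambda>x. (snd \<circ> inv_into ({l} \<times> ?S) snd) x j)" for i j
    proof (rule Ck_on_cong_open[OF _ _ Ck_on_proj[of _ _ _ j]])
      show "x j = (snd \<circ> inv_into ({l} \<times> ?S) snd) x j" if "x \<in> ?S" for x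
        using that f_inv_into_f[of x snd "{l} \<times> ?S"] img[of l] by simp
    qed simp
    ultimately show ?thesis by (simp add: smooth_on_def img)
  next
    case False
    then have "{l} \<times> ?S \<inter> {l'} \<times> ?S = {}" by blast
    \<comment> \<open>Charts of different copies have disjoint domains, and smoothness on the empty
      set follows from the empty cover.\<close>
    then show ?thesis
      using Ck_on_open_cover[of "{}"] by (simp add: smooth_on_def)
  qed
  have mm: "mtop (copies k (Euclidean_manifold m)) = ?X" "mdim (copies k (Euclidean_manifold m)) = m"
    by (simp_all add: copies_def Euclidean_manifold_def)
  show ?thesis
    unfolding smooth_manifold_def atlas mm
  proof (intro conjI)
    show "(\<Union>(U, \<phi>)\<in>(\<lambda>l. ({l} \<times> ?S, snd)) ` {..<k}. U) = topspace ?X"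
      by (auto simp del: topspace_Euclidean_space)
    show "\<forall>(U, \<phi>)\<in>(\<lambda>l. ({l} \<times> ?S, snd)) ` {..<k}. openin ?X U \<and> openin ?E (\<phi> ` U) \<and>
        homeomorphic_map (subtopology ?X U) (subtopology ?E (\<phi> ` U)) \<phi>"
      using chart by (simp add: img)
    show "\<forall>(U, \<phi>)\<in>(\<lambda>l. ({l} \<times> ?S, snd)) ` {..<k}. \<forall>(V, \<psi>)\<in>(\<lambda>l. ({l} \<times> ?S, snd)) ` {..<k}.
        smooth_on m m (\<phi> ` (U \<inter> V)) (\<psi> \<circ> inv_into U \<phi>)"
      using smooth by simp
  qed (fact haus, fact sec)
qed

section \<open>The simplex and the cube as manifolds\<close>

lemma ratio_self: "q \<in> open_simplex \<Longrightarrow> ratio q e e = 1"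
  using ratio_trans[of q e e e] hom_pt_ratio(2)[of q e e] by (metis divide_self less_irrefl)

lemma open_submanifold_simplex:
  fixes S :: "(complex ^ 'e::finite) set set"
  assumes "S \<subseteq> open_simplex"
  shows "open_submanifold simplex_manifold S =
    \<lparr>mtop = subtopology proj_topology S, mdim = CARD('e) - 1,
     atlas = {(S, affine_coords (CARD('e) - 1) b e) | b e. bij_betw b {..<CARD('e) - 1} (- {e})}\<rparr>"
proof -
  have "open_simplex \<inter> S = S" using assms by blast
  moreover have "{(U \<inter> S, \<phi>) |U \<phi>. \<exists>b e. (U, \<phi>) = (open_simplex, affine_coords (CARD('e) - 1) b e) \<and>
        bij_betw b {..<CARD('e) - 1} (- {e})} =
      {(open_simplex \<inter> S, affine_coords (CARD('e) - 1) b e) | b e. bij_betw b {..<CARD('e) - 1} (- {e})}"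
    by blast
  ultimately show ?thesis
    by (simp add: open_submanifold_def simplex_manifold_def subtopology_subtopology) blast
qed

lemma affine_chart_simplex:
  fixes b :: "nat \<Rightarrow> 'e::finite"
  assumes "bij_betw b {..<CARD('e) - 1} (- {e})"
  shows "affine_chart (CARD('e) - 1) b e open_simplex"
  using assms unfolding affine_chart_def bij_betw_def by (simp add: ratio_self)

lemma affine_chart_cube:
  assumes "e \<notin> T" "bij_betw b {..<card T} T"
  shows "affine_chart (card T) b e (cube T)"
  unfolding affine_chart_def
proof (intro conjI subsetI ballI allI impI)
  show "inj_on b {..<card T}" "e \<notin> b ` {..<card T}"
    using assms by (simp_all add: bij_betw_def)
  show "q \<in> open_simplex" if "q \<in> cube T" for q
    using that unfolding cube_iff[OF assms(1)] by (rule conjunct1)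
  show "ratio q f e = 1" if "q \<in> cube T" "f \<notin> b ` {..<card T}" for q f
    using that assms(2) unfolding cube_iff[OF assms(1)] by (simp add: bij_betw_def)
qed

lemma chart_vec_off: "e \<notin> b ` {..<n} \<Longrightarrow> chart_vec n b u e = 1"
  by (simp add: chart_vec_def)

text \<open>The chart image is an open unit cube. Its openness needs this computation, since the
  cube is in general not open in the simplex and \<open>openin_affine_coords_image\<close> does not
  apply.\<close>

lemma affine_coords_cube:
  assumes e: "e \<notin> T" and b: "bij_betw b {..<card T} T"
  shows "affine_coords (card T) b e ` cube T =
    {u \<in> topspace (Euclidean_space (card T)). \<forall>i\<in>{..<card T}. 0 < u i \<and> u i < 1}"
proof -
  have im: "b ` {..<card T} = T" and inj: "inj_on b {..<card T}" using b by (auto simp: bij_betw_def)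
  have "chart_pt (card T) b u \<in> cube T \<longleftrightarrow> (\<forall>i\<in>{..<card T}. u i < 1)"
    if u: "u \<in> positive_orthant (card T)" for u
  proof -
    have "chart_pt (card T) b u \<in> cube T \<longleftrightarrow> (\<forall>f\<in>T. chart_vec (card T) b u f < 1)"
      unfolding cube_iff[OF e] ratio_chart_pt
      using e chart_pt_in_open_simplex[OF u, of b] by (simp add: chart_vec_off im)
    also have "\<dots> \<longleftrightarrow> (\<forall>i\<in>{..<card T}. chart_vec (card T) b u (b i) < 1)"
    proof -
      have "(\<forall>f\<in>b ` {..<card T}. chart_vec (card T) b u f < 1) \<longleftrightarrow>
          (\<forall>i\<in>{..<card T}. chart_vec (card T) b u (b i) < 1)" by blast
      then show ?thesis unfolding im .
    qed
    finally show ?thesis using inj by (simp add: chart_vec_nth)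
  qed
  then show ?thesis
    unfolding affine_coords_image[OF affine_chart_cube[OF e b]] positive_orthant_def by auto
qed

lemma openin_cube_coords: "openin (Euclidean_space n)
    {u \<in> topspace (Euclidean_space n). \<forall>i\<in>{..<m}. 0 < u i \<and> u i < 1}"
proof (rule openin_Collect_ball)
  fix i
  have "{u \<in> topspace (Euclidean_space n). 0 < u i \<and> u i < 1} =
      {u \<in> topspace (Euclidean_space n). 0 < u i} \<inter> {u \<in> topspace (Euclidean_space n). u i < 1}"
    by auto
  then show "openin (Euclidean_space n) {u \<in> topspace (Euclidean_space n). 0 < u i \<and> u i < 1}"
    by (simp only:) (intro openin_Int openin_Collect_less continuous_map_Euclidean_coord; simp)
qed simp

lemma cube_subset: "T \<noteq> UNIV \<Longrightarrow> cube T \<subseteq> open_simplex"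
  using cube_iff by fast

lemma smooth_manifold_cube:
  assumes "T \<noteq> UNIV"
  shows "smooth_manifold (cube_manifold T)"
  unfolding cube_manifold_def
proof (rule smooth_manifold_affine)
  obtain e where e: "e \<notin> T" using assms by auto
  obtain b where "bij_betw b {..<card T} T"
    using ex_bij_betw_nat_finite[OF finite[of T], unfolded atLeast0LessThan] by (rule exE)
  then have "(cube T, affine_coords (card T) b e) \<in>
      {(cube T, affine_coords (card T) b e) | b e. e \<notin> T \<and> bij_betw b {..<card T} T}"
    using e by blast
  then show "{(cube T, affine_coords (card T) b e) | b e. e \<notin> T \<and> bij_betw b {..<card T} T} \<noteq> {}"
    by (metis empty_iff)
  show "U = cube T \<and> (\<exists>b e. \<phi> = affine_coords (card T) b e \<and> affine_chart (card T) b e (cube T) \<and>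
      openin (Euclidean_space (card T)) (affine_coords (card T) b e ` cube T))"
    if mem: "(U, \<phi>) \<in> {(cube T, affine_coords (card T) b e) | b e. e \<notin> T \<and> bij_betw b {..<card T} T}"
    for U \<phi>
  proof -
    obtain b e where be: "U = cube T" "\<phi> = affine_coords (card T) b e" "e \<notin> T"
      "bij_betw b {..<card T} T" using mem by blast
    then have "openin (Euclidean_space (card T)) (affine_coords (card T) b e ` cube T)"
      using affine_coords_cube[OF be(3,4)] openin_cube_coords[of "card T" "card T"] by simp
    then show ?thesis using be affine_chart_cube[OF be(3,4)] by blast
  qed
qed (rule cube_subset[OF assms])

lemma smooth_manifold_open_simplex:
  fixes S :: "(complex ^ 'e::finite) set set"
  assumes S: "openin (subtopology proj_topology open_simplex) S"
  shows "smooth_manifold (open_submanifold simplex_manifold S)"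
proof -
  let ?N = "CARD('e) - 1"
  have sub: "S \<subseteq> open_simplex"
    using openin_subset[OF S] by (simp add: topspace_sub_simplex)
  obtain e :: 'e where True by simp
  have "card (- {e}) = ?N" by (simp add: Compl_eq_Diff_UNIV)
  then obtain b where b: "bij_betw b {..<?N} (- {e})"
    using ex_bij_betw_nat_finite[OF finite[of "- {e}"], unfolded atLeast0LessThan] by metis
  show ?thesis
    unfolding open_submanifold_simplex[OF sub]
  proof (rule smooth_manifold_affine[OF sub])
    have "(S, affine_coords ?N b e) \<in> {(S, affine_coords ?N b (e::'e)) | b e. bij_betw b {..<?N} (- {e})}"
      using b by blast
    then show "{(S, affine_coords ?N b (e::'e)) | b e. bij_betw b {..<?N} (- {e})} \<noteq> {}" by (metis empty_iff)
    show "U = S \<and> (\<exists>b e. \<phi> = affine_coords ?N b e \<and> affine_chart ?N b e S \<and>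
      openin (Euclidean_space ?N) (affine_coords ?N b e ` S))"
      if mem: "(U, \<phi>) \<in> {(S, affine_coords ?N b (e::'e)) | b e. bij_betw b {..<?N} (- {e})}" for U \<phi>
    proof -
      obtain b e where be: "U = S" "\<phi> = affine_coords ?N b e" "bij_betw b {..<?N} (- {e})"
        using mem by blast
      have "affine_chart ?N b e S"
        by (rule affine_chart_subset[OF affine_chart_simplex[OF be(3)] sub])
      moreover have "openin (Euclidean_space ?N) (affine_coords ?N b e ` S)"
        by (rule openin_affine_coords_image[OF affine_chart_simplex[OF be(3)] S])
      ultimately show ?thesis using be by blast
    qed
  qed
qed

lemma Ck_on_ratio_chart_pt:
  assumes "U \<subseteq> positive_orthant n"
  shows "Ck_on k n U (\<lambda>u. ratio (chart_pt n b u) f e)"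
  unfolding ratio_chart_pt
proof (intro Ck_on_divide Ck_on_chart_vec)
  fix u assume "u \<in> U"
  then have "0 < chart_vec n b u e" using assms by (intro chart_vec_pos) blast
  then show "chart_vec n b u e \<noteq> 0" by simp
qed

section \<open>The cone construction\<close>

text \<open>The graph is abstracted to the sets \<gamma> s, known here only through their traces off
  T. The index l stands for the omitted edge \<open>\<sigma> l\<close>, and \<open>c l\<close>
  orders the other h - 1 edges off T, whose weights become the fiber coordinates.\<close>

locale cone_fibration =
  fixes T :: "'e::finite set" and \<gamma> :: "'e \<Rightarrow> 'e set" and h :: nat and \<sigma> :: "nat \<Rightarrow> 'e"
    and c :: "nat \<Rightarrow> nat \<Rightarrow> 'e"
  assumes h_pos: "0 < h"
    and bij_\<sigma>: "bij_betw \<sigma> {..<h} (- T)"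
    and bij_c: "l < h \<Longrightarrow> bij_betw (c l) {..<h - 1} (- T - {\<sigma> l})"
    and \<gamma>_compl: "s \<notin> T \<Longrightarrow> t \<notin> T \<Longrightarrow> t \<in> \<gamma> s \<longleftrightarrow> t \<noteq> s"
begin

text \<open>The factor by which a cone point with weights M differs from x at coordinate e: a
  generator contributes its weight exactly where it does not vanish.\<close>

definition wgt :: "('e \<Rightarrow> real) \<Rightarrow> 'e \<Rightarrow> real" where
  "wgt M e = 1 + (\<Sum>s\<in>- T. if e \<in> \<gamma> s then 0 else M s)"

text \<open>For t off T only \<gamma> t misses t, so the sum has a single surviving term.\<close>

lemma wgt_compl: "t \<notin> T \<Longrightarrow> wgt M t = 1 + M t"
proof -
  assume t: "t \<notin> T"
  have "(\<Sum>s\<in>- T. if t \<in> \<gamma> s then 0 else M s) = (\<Sum>s\<in>- T. if s = t then M s else 0)"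
    using \<gamma>_compl[OF _ t] by (intro sum.cong) auto
  also have "\<dots> = M t" using t by (simp add: sum.delta)
  finally show ?thesis by (simp add: wgt_def)
qed

lemma wgt_ge_1: "(\<And>s. s \<notin> T \<Longrightarrow> 0 \<le> M s) \<Longrightarrow> 1 \<le> wgt M e"
  unfolding wgt_def using sum_nonneg[of "- T" "\<lambda>s. if e \<in> \<gamma> s then 0 else M s"] by simp

text \<open>The factor reads M only off T, so \<open>excess\<close> and \<open>weight_of\<close>
  need to be compared only there.\<close>

lemma wgt_cong: "(\<And>s. s \<notin> T \<Longrightarrow> M s = M' s) \<Longrightarrow> wgt M e = wgt M' e"
  unfolding wgt_def by (simp cong: if_cong)

lemma \<sigma>_notin: "l < h \<Longrightarrow> \<sigma> l \<notin> T"
  using bij_\<sigma> by (auto simp: bij_betw_def)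

abbreviation excess :: "nat \<Rightarrow> (complex ^ 'e) set \<Rightarrow> 'e \<Rightarrow> real" where
  "excess l q s \<equiv> ratio q s (\<sigma> l) - 1"

text \<open>On \<open>piece l\<close>, where \<open>s\<^sub>0 = \<sigma> l\<close>, the weights \<open>\<mu>\<close> of a point are its excess, and
  \<open>base l\<close> and \<open>logs l\<close> recover \<open>x\<close> and \<open>ln \<mu>\<close>; the inverse is \<open>glue\<close>.\<close>

definition piece :: "nat \<Rightarrow> (complex ^ 'e) set set" where
  "piece l = {q \<in> open_simplex. (\<forall>s\<in>- T - {\<sigma> l}. 1 < ratio q s (\<sigma> l)) \<and>
     (\<forall>e\<in>T. ratio q e (\<sigma> l) < wgt (excess l q) e)}"

definition total :: "(complex ^ 'e) set set" where
  "total = (\<Union>l<h. piece l)"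

definition base :: "nat \<Rightarrow> (complex ^ 'e) set \<Rightarrow> (complex ^ 'e) set" where
  "base l q = hom_pt (\<chi> e. ratio q e (\<sigma> l) / wgt (excess l q) e)"

definition logs :: "nat \<Rightarrow> (complex ^ 'e) set \<Rightarrow> nat \<Rightarrow> real" where
  "logs l q = (\<lambda>i. if i < h - 1 then ln (excess l q (c l i)) else 0)"

text \<open>The value 0 at \<open>\<sigma> l\<close> realizes the omission of that generator; the
  exponential makes all other weights positive for arbitrary real w.\<close>

definition weight_of :: "nat \<Rightarrow> (nat \<Rightarrow> real) \<Rightarrow> 'e \<Rightarrow> real" where
  "weight_of l w s = (if s = \<sigma> l then 0 else exp (w (inv_into {..<h - 1} (c l) s)))"

definition glue :: "(complex ^ 'e) set \<Rightarrow> nat \<Rightarrow> (nat \<Rightarrow> real) \<Rightarrow> (complex ^ 'e) set" where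
  "glue p l w = hom_pt (\<chi> e. ratio p e (\<sigma> l) * wgt (weight_of l w) e)"

section \<open>Separating a point into base point and weights, and the inverse construction\<close>

lemma c_notin: "l < h \<Longrightarrow> i < h - 1 \<Longrightarrow> c l i \<notin> T \<and> c l i \<noteq> \<sigma> l"
  using bij_c[of l] by (auto simp: bij_betw_def)

lemma c_surj: "l < h \<Longrightarrow> s \<notin> T \<Longrightarrow> s \<noteq> \<sigma> l \<Longrightarrow>
  inv_into {..<h - 1} (c l) s < h - 1 \<and> c l (inv_into {..<h - 1} (c l) s) = s"
  using bij_c[of l] inv_into_into[where f = "c l" and A = "{..<h - 1}" and x = s]
    f_inv_into_f[where f = "c l" and A = "{..<h - 1}" and y = s]
  by (simp add: bij_betw_def)

lemma inv_c: "l < h \<Longrightarrow> i < h - 1 \<Longrightarrow> inv_into {..<h - 1} (c l) (c l i) = i"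
  using bij_c[of l] by (simp add: bij_betw_def)

lemma weight_of_nonneg: "0 \<le> weight_of l w s"
  by (simp add: weight_of_def)

lemma wgt_weight_of_pos: "0 < wgt (weight_of l w) e"
  using wgt_ge_1[of "weight_of l w" e, OF weight_of_nonneg] by simp

lemma piece_subset: "piece l \<subseteq> open_simplex"
  by (auto simp: piece_def)

lemma excess_pos:
  assumes "q \<in> piece l" "s \<notin> T" "s \<noteq> \<sigma> l"
  shows "0 < excess l q s"
  using assms by (simp add: piece_def)

lemma wgt_excess_ge_1:
  assumes "q \<in> piece l"
  shows "1 \<le> wgt (excess l q) e"
proof (rule wgt_ge_1)
  fix s assume "s \<notin> T"
  moreover have "ratio q s s = 1" using assms piece_subset by (intro ratio_self) blast
  ultimately show "0 \<le> excess l q s"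
    using excess_pos[OF assms, of s] by (cases "s = \<sigma> l") simp_all
qed

lemma wgt_excess_compl: "s \<notin> T \<Longrightarrow> wgt (excess l q) s = ratio q s (\<sigma> l)"
  by (simp add: wgt_compl)

text \<open>The vector defining \<open>base l q\<close> already has coordinate 1 at
  \<open>\<sigma> l\<close>, because the excess there is 0; no renormalization occurs.\<close>

lemma ratio_base:
  assumes "l < h" "q \<in> piece l"
  shows "ratio (base l q) e (\<sigma> l) = ratio q e (\<sigma> l) / wgt (excess l q) e"
  using assms ratio_self[of q "\<sigma> l"] piece_subset[of l]
  by (simp add: base_def ratio_hom_pt wgt_excess_compl \<sigma>_notin subset_iff)

text \<open>Off T the factor equals the ratio itself, so the quotient is 1. On T the second
  condition in \<open>piece\<close> says exactly that the quotient is below 1.\<close>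

lemma base_in_cube:
  assumes l: "l < h" and q: "q \<in> piece l"
  shows "base l q \<in> cube T"
  unfolding cube_iff[OF \<sigma>_notin[OF l]]
proof (intro conjI allI impI ballI)
  have q': "q \<in> open_simplex" using q piece_subset by blast
  have pos: "0 < wgt (excess l q) e" for e
    using wgt_excess_ge_1[OF q, of e] by simp
  show "base l q \<in> open_simplex"
    unfolding base_def by (intro hom_pt_in_open_simplex) (simp add: pos hom_pt_ratio[OF q'])
  show "ratio (base l q) t (\<sigma> l) = 1" if "t \<notin> T" for t
    unfolding ratio_base[OF l q] wgt_excess_compl[OF that]
    using hom_pt_ratio(2)[OF q', of t "\<sigma> l"] by simp
  show "ratio (base l q) i (\<sigma> l) < 1" if "i \<in> T" for i
    unfolding ratio_base[OF l q] using pos[of i] q that by (simp add: piece_def)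
qed

lemma ratio_glue:
  assumes l: "l < h" and p: "p \<in> cube T"
  shows "ratio (glue p l w) e (\<sigma> l) = ratio p e (\<sigma> l) * wgt (weight_of l w) e"
  using p \<sigma>_notin[OF l]
  by (simp add: glue_def ratio_hom_pt wgt_compl cube_iff[OF \<sigma>_notin[OF l]] weight_of_def)

text \<open>A point of the cube has ratio 1 off T, so after gluing only the factor 1 plus the weight
  remains. This recovery of the weights drives all the inverse identities.\<close>

lemma excess_glue:
  assumes "l < h" "p \<in> cube T" "s \<notin> T"
  shows "excess l (glue p l w) s = weight_of l w s"
  using assms unfolding ratio_glue[OF assms(1,2)]
  by (simp add: wgt_compl cube_iff[OF \<sigma>_notin[OF assms(1)]])

lemma wgt_excess_glue:
  assumes "l < h" "p \<in> cube T"
  shows "wgt (excess l (glue p l w)) e = wgt (weight_of l w) e"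
  by (rule wgt_cong) (rule excess_glue[OF assms])

lemma glue_in_piece:
  assumes l: "l < h" and p: "p \<in> cube T"
  shows "glue p l w \<in> piece l"
proof -
  have p': "p \<in> open_simplex" "\<forall>i\<in>T. ratio p i (\<sigma> l) < 1"
    using p by (auto simp: cube_iff[OF \<sigma>_notin[OF l]])
  have "glue p l w \<in> open_simplex"
    unfolding glue_def
    by (intro hom_pt_in_open_simplex) (simp add: wgt_weight_of_pos hom_pt_ratio[OF p'(1)])
  moreover have "1 < ratio (glue p l w) s (\<sigma> l)" if "s \<in> - T - {\<sigma> l}" for s
  proof -
    have "0 < weight_of l w s" using that by (simp add: weight_of_def)
    then show ?thesis using excess_glue[OF l p, of s w] that by simp
  qed
  moreover have "ratio (glue p l w) e (\<sigma> l) < wgt (excess l (glue p l w)) e" if "e \<in> T" for e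
    unfolding wgt_excess_glue[OF l p] unfolding ratio_glue[OF l p]
    using p'(2) that wgt_weight_of_pos[of l w e] by simp
  ultimately show ?thesis unfolding piece_def by blast
qed

lemma base_glue:
  assumes l: "l < h" and p: "p \<in> cube T"
  shows "base l (glue p l w) = p"
proof -
  have "p \<in> open_simplex" using p by (auto simp: cube_iff[OF \<sigma>_notin[OF l]])
  moreover have "ratio (glue p l w) e (\<sigma> l) / wgt (excess l (glue p l w)) e = ratio p e (\<sigma> l)" for e
    unfolding wgt_excess_glue[OF l p] unfolding ratio_glue[OF l p]
    using wgt_weight_of_pos[of l w e] by simp
  ultimately show ?thesis unfolding base_def by (simp add: hom_pt_ratio)
qed

lemma logs_glue:
  assumes l: "l < h" and p: "p \<in> cube T" and w: "w \<in> topspace (Euclidean_space (h - 1))"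
  shows "logs l (glue p l w) = w"
proof
  fix i
  show "logs l (glue p l w) i = w i"
  proof (cases "i < h - 1")
    case True
    then show ?thesis
      using excess_glue[OF l p, of "c l i" w] c_notin[OF l True] inv_c[OF l True]
      by (simp add: logs_def weight_of_def)
  qed (use w in \<open>auto simp: logs_def topspace_Euclidean_space\<close>)
qed

lemma glue_base_logs:
  assumes l: "l < h" and q: "q \<in> piece l"
  shows "glue (base l q) l (logs l q) = q"
proof -
  have q': "q \<in> open_simplex" using q piece_subset by blast
  have "weight_of l (logs l q) s = excess l q s" if "s \<notin> T" for s
    using excess_pos[OF q that] c_surj[OF l that] ratio_self[OF q']
    by (cases "s = \<sigma> l") (simp_all add: weight_of_def logs_def)
  then have "wgt (weight_of l (logs l q)) e = wgt (excess l q) e" for e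
    by (rule wgt_cong)
  moreover have "wgt (excess l q) e \<noteq> 0" for e
    using wgt_excess_ge_1[OF q, of e] by simp
  ultimately have "ratio (base l q) e (\<sigma> l) * wgt (weight_of l (logs l q)) e = ratio q e (\<sigma> l)" for e
    by (simp add: ratio_base[OF l q])
  then show ?thesis unfolding glue_def using hom_pt_ratio(1)[OF q'] by simp
qed

lemma logs_in_Euclidean: "logs l q \<in> topspace (Euclidean_space (h - 1))"
  by (simp add: logs_def topspace_Euclidean_space)

text \<open>On \<open>piece l\<close> the coordinate at \<open>\<sigma> l\<close> is the strict
  minimum off T. Two different strict minima would give two reciprocal ratios both above 1.\<close>

lemma piece_inject:
  assumes "l < h" "l' < h" "q \<in> piece l" "q \<in> piece l'"
  shows "l = l'"
proof (rule ccontr)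
  assume "l \<noteq> l'"
  then have ne: "\<sigma> l \<noteq> \<sigma> l'"
    using bij_\<sigma> assms by (auto simp: bij_betw_def inj_on_def)
  then have "1 < ratio q (\<sigma> l') (\<sigma> l)" "1 < ratio q (\<sigma> l) (\<sigma> l')"
    using excess_pos[OF assms(3), of "\<sigma> l'"] excess_pos[OF assms(4), of "\<sigma> l"] \<sigma>_notin assms by auto
  moreover have "ratio q (\<sigma> l) (\<sigma> l') = 1 / ratio q (\<sigma> l') (\<sigma> l)"
    using ratio_trans[of q "\<sigma> l" "\<sigma> l'" "\<sigma> l"] ratio_self[of q "\<sigma> l"] assms(3) piece_subset by auto
  ultimately show False by simp
qed

definition idx :: "(complex ^ 'e) set \<Rightarrow> nat" where
  "idx q = (THE l. l < h \<and> q \<in> piece l)"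

lemma idx_eq:
  assumes "l < h" "q \<in> piece l"
  shows "idx q = l"
  unfolding idx_def
proof (rule the_equality)
  show "l < h \<and> q \<in> piece l" using assms by (rule conjI)
  show "l' = l" if "l' < h \<and> q \<in> piece l'" for l'
    using piece_inject[OF _ assms(1) _ assms(2), of l'] that by simp
qed

definition proj :: "(complex ^ 'e) set \<Rightarrow> (complex ^ 'e) set" where
  "proj q = base (idx q) q"

definition triv :: "(complex ^ 'e) set \<Rightarrow> (complex ^ 'e) set \<times> nat \<times> (nat \<Rightarrow> real)" where
  "triv q = (proj q, idx q, logs (idx q) q)"

lemma proj_eq: "l < h \<Longrightarrow> q \<in> piece l \<Longrightarrow> proj q = base l q"
  by (simp add: proj_def idx_eq)

lemma triv_eq: "l < h \<Longrightarrow> q \<in> piece l \<Longrightarrow> triv q = (base l q, l, logs l q)"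
  by (simp add: triv_def proj_def idx_eq)

abbreviation trivial_space :: "((complex ^ 'e) set \<times> nat \<times> (nat \<Rightarrow> real)) set" where
  "trivial_space \<equiv> cube T \<times> {..<h} \<times> topspace (Euclidean_space (h - 1))"

lemma totalE:
  assumes "q \<in> total"
  obtains l where "l < h" "q \<in> piece l"
  using assms unfolding total_def by (rule UN_E) (rule that, simp_all)

lemma triv_glue:
  assumes "(p, l, w) \<in> trivial_space"
  shows "glue p l w \<in> total" "triv (glue p l w) = (p, l, w)"
proof -
  have *: "p \<in> cube T" "l < h" "w \<in> topspace (Euclidean_space (h - 1))" using assms by auto
  show "glue p l w \<in> total"
    unfolding total_def using glue_in_piece[OF *(2,1)] *(2) by (intro UN_I[of l]) simp_all
  show "triv (glue p l w) = (p, l, w)"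
    using * by (simp add: triv_eq[OF *(2) glue_in_piece[OF *(2,1)]] base_glue logs_glue)
qed

lemma bij_betw_triv: "bij_betw triv total trivial_space"
proof (rule bij_betw_byWitness[where f' = "\<lambda>(p, l, w). glue p l w"])
  show "\<forall>q\<in>total. (case triv q of (p, l, w) \<Rightarrow> glue p l w) = q"
  proof
    fix q assume "q \<in> total"
    then obtain l where "l < h" "q \<in> piece l" by (rule totalE)
    then show "(case triv q of (p, l, w) \<Rightarrow> glue p l w) = q"
      by (simp add: triv_eq glue_base_logs)
  qed
  show "\<forall>x\<in>trivial_space. triv (case x of (p, l, w) \<Rightarrow> glue p l w) = x"
    using triv_glue(2) by fast
  show "triv ` total \<subseteq> trivial_space"
  proof (intro image_subsetI)
    fix q assume "q \<in> total"
    then obtain l where "l < h" "q \<in> piece l" by (rule totalE)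
    then show "triv q \<in> trivial_space"
      using base_in_cube logs_in_Euclidean by (simp add: triv_eq)
  qed
  show "(\<lambda>(p, l, w). glue p l w) ` trivial_space \<subseteq> total"
    using triv_glue(1) by fast
qed

lemma inv_into_triv:
  assumes "(p, l, w) \<in> trivial_space"
  shows "inv_into total triv (p, l, w) = glue p l w"
  by (rule inv_into_f_eq) (use bij_betw_triv triv_glue[OF assms] in \<open>auto simp: bij_betw_def\<close>)

lemma total_subset: "total \<subseteq> open_simplex"
  using piece_subset by (auto simp: total_def)

lemma proj_total: "proj ` total = cube T"
proof -
  \<comment> \<open>The fiber is nonempty because h is positive, which makes the projection onto the
    cube surjective.\<close>
  have "0 \<in> {..<h}" "(\<lambda>i. 0) \<in> topspace (Euclidean_space (h - 1))"
    using h_pos by (simp_all add: topspace_Euclidean_space)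
  then have "fst ` trivial_space = cube T" by force
  moreover have "fst ` trivial_space = fst ` triv ` total"
    using bij_betw_triv by (simp add: bij_betw_def)
  ultimately show ?thesis by (simp add: image_image triv_def)
qed

section \<open>Continuity of the trivialization and of its inverse\<close>

lemma continuous_map_wgt:
  assumes "\<And>s. s \<notin> T \<Longrightarrow> continuous_map X euclideanreal (\<lambda>x. M x s)"
  shows "continuous_map X euclideanreal (\<lambda>x. wgt (M x) e)"
  unfolding wgt_def
proof (intro continuous_map_add continuous_map_sum)
  show "continuous_map X euclideanreal (\<lambda>x. if e \<in> \<gamma> s then 0 else M x s)" if "s \<in> - T" for s
    using assms[of s] that by (cases "e \<in> \<gamma> s") simp_all
qed simp_all

lemma Ck_on_wgt:
  assumes "\<And>s. s \<notin> T \<Longrightarrow> Ck_on k n U (\<lambda>x. M x s)"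
  shows "Ck_on k n U (\<lambda>x. wgt (M x) e)"
  unfolding wgt_def using assms by (intro Ck_on_intros) simp

lemma continuous_map_wgt_excess:
  "X \<subseteq> open_simplex \<Longrightarrow>
    continuous_map (subtopology proj_topology X) euclideanreal (\<lambda>q. wgt (excess l q) e)"
  by (intro continuous_map_wgt continuous_map_diff continuous_map_ratio) simp_all

lemma openin_piece: "openin (subtopology proj_topology open_simplex) (piece l)"
proof -
  let ?X = "subtopology proj_topology open_simplex :: (complex ^ 'e) set topology"
  have "openin ?X {q \<in> topspace ?X. \<forall>s\<in>- T - {\<sigma> l}. 1 < ratio q s (\<sigma> l)}"
    by (intro openin_Collect_ball openin_Collect_less continuous_map_ratio) simp_all
  moreover have "openin ?X {q \<in> topspace ?X. \<forall>e\<in>T. ratio q e (\<sigma> l) < wgt (excess l q) e}"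
    by (intro openin_Collect_ball openin_Collect_less continuous_map_ratio continuous_map_wgt_excess) simp_all
  moreover have "piece l = {q \<in> topspace ?X. \<forall>s\<in>- T - {\<sigma> l}. 1 < ratio q s (\<sigma> l)} \<inter>
      {q \<in> topspace ?X. \<forall>e\<in>T. ratio q e (\<sigma> l) < wgt (excess l q) e}"
    unfolding topspace_sub_simplex[OF order_refl] piece_def
    by (rule set_eqI, unfold Int_iff mem_Collect_eq) iprover
  ultimately show ?thesis by (simp only: openin_Int)
qed

lemma openin_total: "openin (subtopology proj_topology open_simplex) total"
  unfolding total_def by (rule openin_Union) (erule imageE, simp add: openin_piece)

lemma openin_piece_total:
  assumes "l < h"
  shows "openin (subtopology proj_topology total) (piece l)"
proof -
  have "piece l \<subseteq> total" using assms by (auto simp: total_def)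
  then have "openin (subtopology (subtopology proj_topology open_simplex) total) (piece l)"
    using openin_piece openin_total by (simp add: openin_open_subtopology)
  then show ?thesis
    using total_subset by (simp add: subtopology_subtopology Int_absorb1)
qed

lemma compl_nonempty: "T \<noteq> UNIV"
  using \<sigma>_notin[OF h_pos] by auto

lemma base_coord_pos:
  assumes "q \<in> piece l"
  shows "0 < ratio q e (\<sigma> l) / wgt (excess l q) e"
  using wgt_excess_ge_1[OF assms, of e] hom_pt_ratio(2)[of q e "\<sigma> l"] assms piece_subset[of l]
  by (simp add: subset_iff)

lemma continuous_map_base:
  assumes "l < h"
  shows "continuous_map (subtopology proj_topology (piece l)) (subtopology proj_topology (cube T)) (base l)"
proof -
  have top: "topspace (subtopology proj_topology (piece l)) = piece l"
    by (rule topspace_sub_simplex[OF piece_subset])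
  have "continuous_map (subtopology proj_topology (piece l)) (subtopology proj_topology open_simplex) (base l)"
    unfolding base_def
  proof (rule continuous_map_hom_pt)
    show "continuous_map (subtopology proj_topology (piece l)) euclideanreal
        (\<lambda>q. ratio q e (\<sigma> l) / wgt (excess l q) e)" for e
    proof (intro continuous_map_real_divide continuous_map_ratio continuous_map_wgt_excess piece_subset)
      fix q assume "q \<in> topspace (subtopology proj_topology (piece l))"
      then show "wgt (excess l q) e \<noteq> 0" unfolding top using wgt_excess_ge_1[of q l e] by simp
    qed
  qed (simp only: top base_coord_pos)
  then show ?thesis
    using base_in_cube[OF assms] top by (simp add: continuous_map_in_subtopology Pi_iff image_subset_iff)
qed

lemma continuous_map_logs:
  assumes "l < h"
  shows "continuous_map (subtopology proj_topology (piece l)) (Euclidean_space (h - 1)) (logs l)"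
  unfolding logs_def continuous_map_componentwise_Euclidean_space
proof (intro allI impI continuous_map_ln continuous_map_diff continuous_map_ratio piece_subset)
  fix i q assume i: "i < h - 1" and q: "q \<in> topspace (subtopology proj_topology (piece l))"
  then show "0 < excess l q (c l i)"
    using excess_pos[of q l "c l i"] c_notin[OF assms i] by (simp add: topspace_sub_simplex[OF piece_subset])
qed simp

text \<open>The open pieces cover the total space and are disjoint; on each the component in the
  discrete factor is constant and the other two have explicit formulas.\<close>

lemma continuous_map_triv:
  "continuous_map (subtopology proj_topology total)
     (prod_topology (subtopology proj_topology (cube T))
       (prod_topology (discrete_topology {..<h}) (Euclidean_space (h - 1)))) triv" (is "continuous_map ?X ?Y triv")
proof (rule pasting_lemma[where I = "{..<h}" and T = piece and f = "\<lambda>l q. (base l q, l, logs l q)"])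
  fix l assume "l \<in> {..<h}"
  then have l: "l < h" by simp
  show "openin ?X (piece l)" by (rule openin_piece_total[OF l])
  have "piece l \<subseteq> total" using l by (auto simp: total_def)
  then have sub: "subtopology ?X (piece l) = subtopology proj_topology (piece l)"
    by (simp add: subtopology_subtopology Int_absorb1)
  show "continuous_map (subtopology ?X (piece l)) ?Y (\<lambda>q. (base l q, l, logs l q))"
    unfolding sub using continuous_map_base[OF l] continuous_map_logs[OF l] l
    by (simp add: continuous_map_pairwise o_def)
next
  fix i j q assume "i \<in> {..<h}" "j \<in> {..<h}" "q \<in> topspace ?X \<inter> piece i \<inter> piece j"
  then show "(base i q, i, logs i q) = (base j q, j, logs j q)"
    using piece_inject[of i j q] by simp
next
  fix q assume "q \<in> topspace ?X"
  then have "q \<in> total" by (simp add: topspace_sub_simplex[OF total_subset])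
  then obtain l where "l < h" "q \<in> piece l" by (rule totalE)
  then show "\<exists>j. j \<in> {..<h} \<and> q \<in> piece j \<and> triv q = (base j q, j, logs j q)"
    by (intro exI[of _ l]) (simp add: triv_eq)
qed

abbreviation trivial_top :: "((complex ^ 'e) set \<times> nat \<times> (nat \<Rightarrow> real)) topology" where
  "trivial_top \<equiv> prod_topology (subtopology proj_topology (cube T))
       (prod_topology (discrete_topology {..<h}) (Euclidean_space (h - 1)))"

lemma topspace_cube: "topspace (subtopology proj_topology (cube T)) = cube T"
  by (rule topspace_sub_simplex[OF cube_subset[OF compl_nonempty]])

lemma topspace_trivial_top: "topspace trivial_top = trivial_space"
  by (simp only: topspace_prod_topology topspace_cube topspace_discrete_topology)

text \<open>The index l is held fixed instead of being read off x, so one formula is continuous on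
  the whole product; only its restriction to sheet l is used afterwards.\<close>

lemma continuous_map_glue:
  "continuous_map trivial_top (subtopology proj_topology open_simplex) (\<lambda>x. glue (fst x) l (snd (snd x)))"
  unfolding glue_def
proof (rule continuous_map_hom_pt)
  have w: "continuous_map trivial_top euclideanreal (\<lambda>x. snd (snd x) i)" for i
    using continuous_map_compose[OF continuous_map_compose[OF continuous_map_snd continuous_map_snd]
        continuous_map_Euclidean_coord[of "h - 1" i]]
    by (simp add: o_def)
  have r: "continuous_map trivial_top euclideanreal (\<lambda>x. ratio (fst x) e (\<sigma> l))" for e
    using continuous_map_compose[OF continuous_map_fst
        continuous_map_ratio[OF cube_subset[OF compl_nonempty], of e "\<sigma> l"]]
    by (simp add: o_def)
  have "continuous_map trivial_top euclideanreal (\<lambda>x. weight_of l (snd (snd x)) s)" for s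
  proof (cases "s = \<sigma> l")
    case False
    show ?thesis
      unfolding weight_of_def if_not_P[OF False] by (rule continuous_map_exp[OF w])
  qed (simp add: weight_of_def)
  then show "continuous_map trivial_top euclideanreal
      (\<lambda>x. ratio (fst x) e (\<sigma> l) * wgt (weight_of l (snd (snd x))) e)" for e
    by (intro continuous_map_real_mult r continuous_map_wgt)
  fix x e assume "x \<in> topspace trivial_top"
  then have "fst x \<in> open_simplex"
    unfolding topspace_trivial_top using cube_subset[OF compl_nonempty] by auto
  then show "0 < ratio (fst x) e (\<sigma> l) * wgt (weight_of l (snd (snd x))) e"
    by (simp add: hom_pt_ratio wgt_weight_of_pos)
qed

text \<open>The sheets with fixed middle component are open because that factor is discrete; on
  sheet l the inverse is \<open>glue\<close> with this l.\<close>

lemma continuous_map_inv_triv: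
  "continuous_map trivial_top (subtopology proj_topology total) (inv_into total triv)"
proof (rule pasting_lemma[where I = "{..<h}" and T = "\<lambda>l. cube T \<times> {l} \<times> topspace (Euclidean_space (h - 1))"
      and f = "\<lambda>l x. glue (fst x) l (snd (snd x))"])
  fix l assume "l \<in> {..<h}"
  then have l: "l < h" by simp
  let ?Y = "subtopology trivial_top (cube T \<times> {l} \<times> topspace (Euclidean_space (h - 1)))"
  have "openin (subtopology proj_topology (cube T)) (cube T)"
    using openin_topspace[of "subtopology proj_topology (cube T)"] unfolding topspace_cube .
  then show "openin trivial_top (cube T \<times> {l} \<times> topspace (Euclidean_space (h - 1)))"
    using l by (simp add: openin_prod_Times_iff)
  have "glue (fst x) l (snd (snd x)) \<in> total" if "x \<in> topspace ?Y" for x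
  proof -
    have "fst x \<in> cube T" using that by auto
    then show ?thesis unfolding total_def using glue_in_piece[OF l] l by (intro UN_I[of l]) simp_all
  qed
  moreover have "continuous_map ?Y proj_topology (\<lambda>x. glue (fst x) l (snd (snd x)))"
    using continuous_map_from_subtopology[OF continuous_map_glue]
    unfolding continuous_map_in_subtopology by (rule conjunct1)
  ultimately show "continuous_map ?Y (subtopology proj_topology total) (\<lambda>x. glue (fst x) l (snd (snd x)))"
    unfolding continuous_map_in_subtopology by (simp add: Pi_iff image_subset_iff)
next
  fix i j x assume "x \<in> topspace trivial_top \<inter> (cube T \<times> {i} \<times> topspace (Euclidean_space (h - 1))) \<inter>
    (cube T \<times> {j} \<times> topspace (Euclidean_space (h - 1)))"
  then have "i = j" by auto
  then show "glue (fst x) i (snd (snd x)) = glue (fst x) j (snd (snd x))" by simp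
next
  fix x assume "x \<in> topspace trivial_top"
  then have x: "x \<in> trivial_space" unfolding topspace_trivial_top .
  obtain p l w where p: "x = (p, l, w)" by (cases x)
  show "\<exists>j. j \<in> {..<h} \<and> x \<in> cube T \<times> {j} \<times> topspace (Euclidean_space (h - 1)) \<and>
      inv_into total triv x = glue (fst x) j (snd (snd x))"
    using x inv_into_triv[of p l w] unfolding p by (intro exI[of _ l]) simp
qed

section \<open>Smoothness of the projection, the trivialization and its inverse in charts\<close>

definition N :: nat where "N = card T + (h - 1)"

text \<open>The dimension of the simplex splits as that of the cube plus that of the fiber, since S
  has h elements.\<close>

lemma N_eq: "CARD('e) - 1 = N"
proof -
  have "card (- T) = h"
    using bij_betw_same_card[OF bij_\<sigma>] by simp
  moreover have "CARD('e) = card T + card (- T)"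
    by (subst card_Un_disjoint[symmetric]) (auto simp: Compl_partition)
  ultimately show ?thesis using h_pos by (simp add: N_def)
qed

lemmas affine_chart_N = affine_chart_simplex[where 'e = 'e, unfolded N_eq]

lemma image_piece_subset:
  assumes "bij_betw b {..<N} (- {e})"
  shows "affine_coords N b e ` piece l \<subseteq> positive_orthant N"
  unfolding affine_coords_image[OF affine_chart_subset[OF affine_chart_N[OF assms] piece_subset]]
  by blast

lemma chart_pt_piece:
  assumes "bij_betw b {..<N} (- {e})" "u \<in> affine_coords N b e ` piece l"
  shows "chart_pt N b u \<in> piece l"
  using assms(2)
  unfolding affine_coords_image[OF affine_chart_subset[OF affine_chart_N[OF assms(1)] piece_subset]]
  by blast

lemma inv_into_total:
  assumes "bij_betw b {..<N} (- {e})" "u \<in> affine_coords N b e ` total"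
  shows "inv_into total (affine_coords N b e) u = chart_pt N b u"
  by (rule inv_into_affine_coords[OF affine_chart_subset[OF affine_chart_N[OF assms(1)] total_subset]
        assms(2)])

lemma Ck_on_wgt_excess:
  assumes "bij_betw b {..<N} (- {e})"
  shows "Ck_on k N (affine_coords N b e ` piece l) (\<lambda>u. wgt (excess l (chart_pt N b u)) f)"
  by (intro Ck_on_wgt Ck_on_diff Ck_on_const Ck_on_ratio_chart_pt image_piece_subset[OF assms])

text \<open>In a chart this is a quotient of two quotients, whose denominators do not vanish because
  the factors are at least 1 and the base coordinates are positive.\<close>

lemma Ck_on_base:
  assumes b: "bij_betw b {..<N} (- {e})"
  shows "Ck_on k N (affine_coords N b e ` piece l) (\<lambda>u. ratio (base l (chart_pt N b u)) f g)"
proof -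
  let ?r = "\<lambda>u f. ratio (chart_pt N b u) f (\<sigma> l) / wgt (excess l (chart_pt N b u)) f"
  have pos: "0 < ?r u f" if "u \<in> affine_coords N b e ` piece l" for u f
    by (rule base_coord_pos[OF chart_pt_piece[OF b that]])
  have "wgt (excess l (chart_pt N b u)) f \<noteq> 0" if "u \<in> affine_coords N b e ` piece l" for u f
    using wgt_excess_ge_1[OF chart_pt_piece[OF b that], of f] by simp
  then have r: "Ck_on k N (affine_coords N b e ` piece l) (\<lambda>u. ?r u f)" for f
    by (intro Ck_on_divide Ck_on_wgt_excess[OF b] Ck_on_ratio_chart_pt image_piece_subset[OF b])
  have "Ck_on k N (affine_coords N b e ` piece l) (\<lambda>u. ?r u f / ?r u g)"
  proof (rule Ck_on_divide[OF r r])
    show "?r u g \<noteq> 0" if "u \<in> affine_coords N b e ` piece l" for u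
      by (rule less_imp_neq[OF pos[OF that], symmetric])
  qed
  then show ?thesis by (simp add: base_def ratio_hom_pt)
qed

lemma Ck_on_logs:
  assumes b: "bij_betw b {..<N} (- {e})" and l: "l < h" and i: "i < h - 1"
  shows "Ck_on k N (affine_coords N b e ` piece l) (\<lambda>u. logs l (chart_pt N b u) i)"
proof -
  have "Ck_on k N (affine_coords N b e ` piece l) (\<lambda>u. ln (excess l (chart_pt N b u) (c l i)))"
  proof (intro Ck_on_ln Ck_on_diff Ck_on_const Ck_on_ratio_chart_pt image_piece_subset[OF b])
    fix u assume "u \<in> affine_coords N b e ` piece l"
    then show "0 < excess l (chart_pt N b u) (c l i)"
      using c_notin[OF l i] by (intro excess_pos chart_pt_piece[OF b]) simp_all
  qed
  then show ?thesis using i by (simp add: logs_def)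
qed

lemma openin_image_piece:
  assumes "bij_betw b {..<N} (- {e})"
  shows "openin (Euclidean_space N) (affine_coords N b e ` piece l)"
  by (rule openin_affine_coords_image[OF affine_chart_N[OF assms] openin_piece])

lemma piece_subset_total: "l < h \<Longrightarrow> piece l \<subseteq> total"
  unfolding total_def by (rule UN_upper) simp

abbreviation total_manifold :: "(complex ^ 'e) set manifold" where
  "total_manifold \<equiv> open_submanifold simplex_manifold total"

lemmas total_manifold_eq = open_submanifold_simplex[OF total_subset, unfolded N_eq]

lemma total_manifold_simps:
  "mtop total_manifold = subtopology proj_topology total" "mdim total_manifold = N"
  unfolding total_manifold_eq by simp_all

lemma total_manifold_chart:
  assumes "(U, \<phi>) \<in> atlas total_manifold"
  obtains b e where "U = total" "\<phi> = affine_coords N b e" "bij_betw b {..<N} (- {e})"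
proof -
  have "(U, \<phi>) \<in> {(total, affine_coords N b e) | b e. bij_betw b {..<N} (- {e})}"
    using assms unfolding total_manifold_eq by simp
  then show ?thesis using that by blast
qed

lemma cube_manifold_simps:
  "mtop (cube_manifold T) = subtopology proj_topology (cube T)" "mdim (cube_manifold T) = card T"
  by (simp_all add: cube_manifold_def)

lemma cube_manifold_chart:
  assumes "(U, \<phi>) \<in> atlas (cube_manifold T)"
  obtains b e where "U = cube T" "\<phi> = affine_coords (card T) b e" "e \<notin> T" "bij_betw b {..<card T} T"
proof -
  have "(U, \<phi>) \<in> {(cube T, affine_coords (card T) b e) | b e. e \<notin> T \<and> bij_betw b {..<card T} T}"
    using assms by (simp add: cube_manifold_def)
  then show ?thesis using that by blast
qed

abbreviation trivial_manifold :: "((complex ^ 'e) set \<times> nat \<times> (nat \<Rightarrow> real)) manifold" where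
  "trivial_manifold \<equiv> prod_manifold (cube_manifold T) (copies h (Euclidean_manifold (h - 1)))"

abbreviation trivial_chart :: "(nat \<Rightarrow> 'e) \<Rightarrow> 'e \<Rightarrow> (complex ^ 'e) set \<times> nat \<times> (nat \<Rightarrow> real) \<Rightarrow> nat \<Rightarrow> real" where
  "trivial_chart b e \<equiv>
    (\<lambda>x i. if i < card T then affine_coords (card T) b e (fst x) i else snd (snd x) (i - card T))"

lemma trivial_manifold_simps:
  "mtop trivial_manifold = trivial_top" "mdim trivial_manifold = card T + (h - 1)"
  by (simp_all add: prod_manifold_def cube_manifold_def copies_def Euclidean_manifold_def)

lemma trivial_manifold_chart:
  assumes "(U, \<phi>) \<in> atlas trivial_manifold"
  obtains b e l where "U = cube T \<times> {l} \<times> topspace (Euclidean_space (h - 1))" "\<phi> = trivial_chart b e"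
    "l < h" "e \<notin> T" "bij_betw b {..<card T} T"
proof -
  obtain V \<psi> W \<theta> where *: "U = V \<times> W"
    "\<phi> = (\<lambda>(x, y) i. if i < card T then \<psi> x i else \<theta> y (i - card T))"
    "(V, \<psi>) \<in> atlas (cube_manifold T)" "(W, \<theta>) \<in> atlas (copies h (Euclidean_manifold (h - 1)))"
    using assms
    unfolding prod_manifold_def manifold.simps cube_manifold_simps(2) mem_Collect_eq prod.inject
    by (elim exE conjE) (rule that)
  obtain b e where be: "V = cube T" "\<psi> = affine_coords (card T) b e" "e \<notin> T" "bij_betw b {..<card T} T"
    using *(3) by (rule cube_manifold_chart)
  have "\<exists>l<h. W = {l} \<times> topspace (Euclidean_space (h - 1)) \<and> \<theta> = snd"
    using *(4) by (auto simp: copies_def Euclidean_manifold_def)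
  then obtain l where l: "l < h" "W = {l} \<times> topspace (Euclidean_space (h - 1))" "\<theta> = snd" by blast
  have "\<phi> = trivial_chart b e"
    unfolding *(2) be(2) l(3) by (simp add: fun_eq_iff)
  then show ?thesis using that[of l b e] *(1) be l by simp
qed

text \<open>Stated for any p agreeing with \<open>proj\<close> on the total space, since
  \<open>pi_T\<close> is identified with \<open>proj\<close> only there.\<close>

lemma smooth_map_proj:
  assumes p: "\<And>q. q \<in> total \<Longrightarrow> p q = proj q"
  shows "smooth_map total_manifold (cube_manifold T) p"
  unfolding smooth_map_def total_manifold_simps cube_manifold_simps
proof (intro conjI)
  have "continuous_map (subtopology proj_topology total) (subtopology proj_topology (cube T)) (fst \<circ> triv)"
    by (rule continuous_map_compose[OF continuous_map_triv continuous_map_fst])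
  then show "continuous_map (subtopology proj_topology total) (subtopology proj_topology (cube T)) p"
    by (rule continuous_map_eq) (simp add: topspace_sub_simplex[OF total_subset] triv_def p)
  have "smooth_on N (card T) (\<phi> ` {q \<in> U. p q \<in> V}) (\<psi> \<circ> p \<circ> inv_into U \<phi>)"
    if U: "(U, \<phi>) \<in> atlas total_manifold" and V: "(V, \<psi>) \<in> atlas (cube_manifold T)" for U \<phi> V \<psi>
  proof -
    obtain b e where be: "U = total" "\<phi> = affine_coords N b e" "bij_betw b {..<N} (- {e})"
      using U by (rule total_manifold_chart)
    obtain b' e' where be': "V = cube T" "\<psi> = affine_coords (card T) b' e'"
      using V by (rule cube_manifold_chart)
    have dom: "{q \<in> U. p q \<in> V} = total"
      unfolding be be' using p proj_total by auto
    have "Ck_on k N (\<phi> ` total) (\<lambda>u. (\<psi> \<circ> p \<circ> inv_into U \<phi>) u j)" if j: "j < card T" for j k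
    \<comment> \<open>A chart of the cube does not determine the sheet, so its domain pulls back to
      the whole total space and is covered by the images of the pieces.\<close>
    proof (rule Ck_on_open_cover)
      fix u assume "u \<in> \<phi> ` total"
      then obtain q where q: "q \<in> total" "u = \<phi> q" by blast
      obtain l where l: "l < h" "q \<in> piece l" using q(1) by (rule totalE)
      have "Ck_on k N (\<phi> ` piece l) (\<lambda>u. (\<psi> \<circ> p \<circ> inv_into U \<phi>) u j)"
        unfolding be(1,2) be'(2)
      proof (rule Ck_on_cong_open[OF openin_image_piece[OF be(3)] _ Ck_on_base[OF be(3)]])
        fix u assume u: "u \<in> affine_coords N b e ` piece l"
        then have "u \<in> affine_coords N b e ` total" using piece_subset_total[OF l(1)] by blast
        then have inv: "inv_into total (affine_coords N b e) u = chart_pt N b u"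
          by (rule inv_into_total[OF be(3)])
        have c: "chart_pt N b u \<in> piece l" by (rule chart_pt_piece[OF be(3) u])
        then have "p (chart_pt N b u) = base l (chart_pt N b u)"
          using p[of "chart_pt N b u"] piece_subset_total[OF l(1)] proj_eq[OF l(1) c] by auto
        then show "ratio (base l (chart_pt N b u)) (b' j) e' =
            (affine_coords (card T) b' e' \<circ> p \<circ> inv_into total (affine_coords N b e)) u j"
          unfolding o_apply inv affine_coords_def[of "card T" b'] using j by simp
      qed
      then show "\<exists>V. u \<in> V \<and> V \<subseteq> \<phi> ` total \<and> openin (Euclidean_space N) V \<and>
          Ck_on k N V (\<lambda>u. (\<psi> \<circ> p \<circ> inv_into U \<phi>) u j)"
        using q(2) l(2) image_mono[OF piece_subset_total[OF l(1)], of \<phi>] openin_image_piece[OF be(3), of l]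
        unfolding be(2) by (intro exI[of _ "affine_coords N b e ` piece l"] conjI) simp_all
    qed
    then show ?thesis unfolding smooth_on_def dom by blast
  qed
  then show "\<forall>(U, \<phi>)\<in>atlas total_manifold. \<forall>(V, \<psi>)\<in>atlas (cube_manifold T).
      smooth_on N (card T) (\<phi> ` {p' \<in> U. p p' \<in> V}) (\<psi> \<circ> p \<circ> inv_into U \<phi>)"
    by fast
qed

lemma smooth_map_triv: "smooth_map total_manifold trivial_manifold triv"
  unfolding smooth_map_def total_manifold_simps trivial_manifold_simps
proof (intro conjI)
  show "continuous_map (subtopology proj_topology total) trivial_top triv"
    by (rule continuous_map_triv)
  have "smooth_on N (card T + (h - 1)) (\<phi> ` {q \<in> U. triv q \<in> V}) (\<psi> \<circ> triv \<circ> inv_into U \<phi>)"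
    if U: "(U, \<phi>) \<in> atlas total_manifold" and V: "(V, \<psi>) \<in> atlas trivial_manifold" for U \<phi> V \<psi>
  proof -
    obtain b e where be: "U = total" "\<phi> = affine_coords N b e" "bij_betw b {..<N} (- {e})"
      using U by (rule total_manifold_chart)
    obtain b' e' l where be': "V = cube T \<times> {l} \<times> topspace (Euclidean_space (h - 1))"
      "\<psi> = trivial_chart b' e'" "l < h" using V by (rule trivial_manifold_chart)
    have dom: "{q \<in> U. triv q \<in> V} = piece l"
    proof (intro equalityI subsetI)
      fix q assume q: "q \<in> {q \<in> U. triv q \<in> V}"
      then obtain l' where l': "l' < h" "q \<in> piece l'" unfolding be(1) by (auto elim: totalE)
      then have "l' = l" using q by (simp add: be' triv_eq)
      then show "q \<in> piece l" using l' by simp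
    next
      fix q assume q: "q \<in> piece l"
      then show "q \<in> {q \<in> U. triv q \<in> V}"
        using base_in_cube[OF be'(3) q] logs_in_Euclidean[of l q] piece_subset_total[OF be'(3)]
        by (auto simp: be(1) be'(1) triv_eq[OF be'(3) q] simp del: topspace_Euclidean_space)
    qed
    have inv: "(\<psi> \<circ> triv \<circ> inv_into U \<phi>) u =
        trivial_chart b' e' (base l (chart_pt N b u), l, logs l (chart_pt N b u))"
      if u: "u \<in> affine_coords N b e ` piece l" for u
    proof -
      have "u \<in> affine_coords N b e ` total" using u piece_subset_total[OF be'(3)] by blast
      then have "inv_into total (affine_coords N b e) u = chart_pt N b u"
        by (rule inv_into_total[OF be(3)])
      then show ?thesis
        using triv_eq[OF be'(3) chart_pt_piece[OF be(3) u]] by (simp only: be be' o_apply)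
    qed
    have "Ck_on k N (affine_coords N b e ` piece l) (\<lambda>u. (\<psi> \<circ> triv \<circ> inv_into U \<phi>) u j)"
      if j: "j < card T + (h - 1)" for j k
    proof (cases "j < card T")
      case True
      show ?thesis
      proof (rule Ck_on_cong_open[OF openin_image_piece[OF be(3)] _ Ck_on_base[OF be(3)]])
        fix u assume u: "u \<in> affine_coords N b e ` piece l"
        show "ratio (base l (chart_pt N b u)) (b' j) e' = (\<psi> \<circ> triv \<circ> inv_into U \<phi>) u j"
          unfolding inv[OF u] using True by (simp add: affine_coords_def[of "card T" b'])
      qed
    next
      case False
      then have j': "j - card T < h - 1" using j by simp
      show ?thesis
      proof (rule Ck_on_cong_open[OF openin_image_piece[OF be(3)] _ Ck_on_logs[OF be(3) be'(3) j']])
        fix u assume u: "u \<in> affine_coords N b e ` piece l"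
        show "logs l (chart_pt N b u) (j - card T) = (\<psi> \<circ> triv \<circ> inv_into U \<phi>) u j"
          unfolding inv[OF u] using False by simp
      qed
    qed
    then show ?thesis unfolding smooth_on_def dom be(2) by blast
  qed
  then show "\<forall>(U, \<phi>)\<in>atlas total_manifold. \<forall>(V, \<psi>)\<in>atlas trivial_manifold.
      smooth_on N (card T + (h - 1)) (\<phi> ` {p \<in> U. triv p \<in> V}) (\<psi> \<circ> triv \<circ> inv_into U \<phi>)"
    by fast
qed

text \<open>Needed because a point in the product chart carries the fiber coordinates behind the
  first \<open>card T\<close> entries.\<close>

lemma chart_vec_cong: "(\<And>i. i < n \<Longrightarrow> u i = v i) \<Longrightarrow> chart_vec n b u f = chart_vec n b v f"
  using inv_into_into[where f = b and A = "{..<n}" and x = f] by (simp add: chart_vec_def)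

text \<open>The image is an open unit cube times a full Euclidean space; a preimage is found by
  splitting the sequence u at position \<open>card T\<close>.\<close>

lemma trivial_chart_image:
  assumes "e \<notin> T" "bij_betw b {..<card T} T"
  shows "trivial_chart b e ` (cube T \<times> {l} \<times> topspace (Euclidean_space (h - 1))) =
    {u \<in> topspace (Euclidean_space (card T + (h - 1))). \<forall>i\<in>{..<card T}. 0 < u i \<and> u i < 1}"
    (is "_ ` ?V = ?W")
proof (intro equalityI image_subsetI subsetI)
  fix x assume x: "x \<in> ?V"
  have "affine_coords (card T) b e (fst x) \<in> affine_coords (card T) b e ` cube T"
    using x by (intro imageI) (simp add: mem_Times_iff)
  then have 1: "\<forall>i\<in>{..<card T}. 0 < affine_coords (card T) b e (fst x) i \<and> affine_coords (card T) b e (fst x) i < 1"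
    unfolding affine_coords_cube[OF assms] by blast
  have 2: "\<forall>i\<ge>h - 1. snd (snd x) i = 0"
    using x by (simp add: mem_Times_iff topspace_Euclidean_space)
  show "trivial_chart b e x \<in> ?W"
    unfolding topspace_Euclidean_space mem_Collect_eq
  proof (intro conjI allI impI)
    fix i assume "card T + (h - 1) \<le> i"
    then have "\<not> i < card T" "h - 1 \<le> i - card T" by linarith+
    then show "trivial_chart b e x i = 0" using 2 by simp
  qed (use 1 in simp)
next
  fix u assume u: "u \<in> ?W"
  define v where "v i = (if i < card T then u i else 0)" for i
  define w where "w i = u (i + card T)" for i
  have "v \<in> affine_coords (card T) b e ` cube T"
    unfolding affine_coords_cube[OF assms] using u by (simp add: v_def topspace_Euclidean_space)
  then obtain p where p: "p \<in> cube T" "v = affine_coords (card T) b e p" by blast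
  have "trivial_chart b e (p, l, w) = u"
    unfolding fst_conv snd_conv p(2)[symmetric] by (rule ext) (simp add: v_def w_def)
  moreover have "w \<in> topspace (Euclidean_space (h - 1))"
    using u by (simp add: w_def topspace_Euclidean_space)
  then have "(p, l, w) \<in> ?V" using p(1) by simp
  ultimately show "u \<in> trivial_chart b e ` ?V" by (rule image_eqI[OF sym])
qed

text \<open>The chart forgets the sheet index, which is harmless as it is constant on the chart
  domain.\<close>

lemma inj_on_trivial_chart:
  assumes "e \<notin> T" "bij_betw b {..<card T} T"
  shows "inj_on (trivial_chart b e) (cube T \<times> {l} \<times> topspace (Euclidean_space (h - 1)))"
proof (rule inj_onI)
  fix x y assume x: "x \<in> cube T \<times> {l} \<times> topspace (Euclidean_space (h - 1))"
    and y: "y \<in> cube T \<times> {l} \<times> topspace (Euclidean_space (h - 1))"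
    and eq: "trivial_chart b e x = trivial_chart b e y"
  have "affine_coords (card T) b e (fst x) i = affine_coords (card T) b e (fst y) i" for i
    using fun_cong[OF eq, of i] by (cases "i < card T") (simp_all add: affine_coords_def)
  then have "affine_coords (card T) b e (fst x) = affine_coords (card T) b e (fst y)" by (rule ext)
  then have "fst x = fst y"
    using x y chart_pt_affine_coords[OF affine_chart_cube[OF assms], of "fst x"]
      chart_pt_affine_coords[OF affine_chart_cube[OF assms], of "fst y"]
    by (metis mem_Sigma_iff prod.collapse)
  moreover have "snd (snd x) i = snd (snd y) i" for i
    using fun_cong[OF eq, of "i + card T"] by simp
  then have "snd (snd x) = snd (snd y)" by (rule ext)
  moreover have "fst (snd x) = fst (snd y)" using x y by auto
  ultimately show "x = y" by (simp add: prod_eq_iff)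
qed

lemma smooth_map_inv_triv: "smooth_map trivial_manifold total_manifold (inv_into total triv)"
  unfolding smooth_map_def total_manifold_simps trivial_manifold_simps
proof (intro conjI)
  show "continuous_map trivial_top (subtopology proj_topology total) (inv_into total triv)"
    by (rule continuous_map_inv_triv)
  have "smooth_on (card T + (h - 1)) N (\<psi> ` {x \<in> V. inv_into total triv x \<in> U})
      (\<phi> \<circ> inv_into total triv \<circ> inv_into V \<psi>)"
    if U: "(U, \<phi>) \<in> atlas total_manifold" and V: "(V, \<psi>) \<in> atlas trivial_manifold" for U \<phi> V \<psi>
  proof -
    obtain b e where be: "U = total" "\<phi> = affine_coords N b e" "bij_betw b {..<N} (- {e})"
      using U by (rule total_manifold_chart)
    obtain b' e' l where be': "V = cube T \<times> {l} \<times> topspace (Euclidean_space (h - 1))"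
      "\<psi> = trivial_chart b' e'" "l < h" "e' \<notin> T" "bij_betw b' {..<card T} T"
      using V by (rule trivial_manifold_chart)
    let ?n = "card T + (h - 1)"
    \<comment> \<open>Homogeneous coordinates of the glued point in terms of chart coordinates: the
      first \<open>card T\<close> entries give the base point, and the shift by
      \<open>card T\<close> finds the logarithmic weights.\<close>
    let ?y = "\<lambda>u f. chart_vec (card T) b' u f * wgt (weight_of l (\<lambda>i. u (i + card T))) f"
    have VT: "V \<subseteq> trivial_space" using be'(3) unfolding be'(1) by blast
    have "inv_into total triv x \<in> total" if "x \<in> V" for x
      using that VT bij_betw_triv inv_into_into[of x triv total] by (auto simp: bij_betw_def)
    then have dom: "{x \<in> V. inv_into total triv x \<in> U} = V" unfolding be(1) by blast
    have op: "openin (Euclidean_space ?n) (\<psi> ` V)"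
      unfolding be'(1,2) trivial_chart_image[OF be'(4,5)] by (rule openin_cube_coords)
    have val: "(\<forall>f. 0 < ?y u f) \<and>
        (\<forall>j<N. ?y u (b j) / ?y u e = (\<phi> \<circ> inv_into total triv \<circ> inv_into V \<psi>) u j)"
      if u: "u \<in> \<psi> ` V" for u
    proof -
      obtain x where x: "x \<in> V" "u = \<psi> x" using u by blast
      obtain p w where p: "x = (p, l, w)" "p \<in> cube T" "w \<in> topspace (Euclidean_space (h - 1))"
        using x(1) unfolding be'(1) by auto
      have inv: "inv_into V \<psi> u = x"
        unfolding x(2) using inj_on_trivial_chart[OF be'(4,5)] x(1)
        unfolding be'(1,2) by (rule inv_into_f_f)
      have w: "(\<lambda>i. u (i + card T)) = w"
        unfolding x(2) p(1) be'(2) by simp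
      have pr: "p \<in> open_simplex" using p(2) cube_subset[OF compl_nonempty] by blast
      \<comment> \<open>The chart normalizes at e', \<open>glue\<close> at
        \<open>\<sigma> l\<close>. Both lie off T, where all coordinates of a cube point agree, so
        the representatives coincide.\<close>
      have c: "chart_vec (card T) b' u f = ratio p f (\<sigma> l)" for f
      proof -
        have "chart_vec (card T) b' u f = chart_vec (card T) b' (affine_coords (card T) b' e' p) f"
          unfolding x(2) p(1) be'(2) by (rule chart_vec_cong) simp
        also have "\<dots> = chart_vec (card T) b' (affine_coords (card T) b' e' p) f /
            chart_vec (card T) b' (affine_coords (card T) b' e' p) (\<sigma> l)"
          using \<sigma>_notin[OF be'(3)] be'(5) by (simp add: chart_vec_off bij_betw_def)
        also have "\<dots> = ratio p f (\<sigma> l)"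
          unfolding ratio_chart_pt[symmetric] chart_pt_affine_coords[OF affine_chart_cube[OF be'(4,5)] p(2)] ..
        finally show ?thesis .
      qed
      have "0 < ?y u f" for f by (simp add: c wgt_weight_of_pos hom_pt_ratio(2)[OF pr])
      moreover have "?y u (b j) / ?y u e = (\<phi> \<circ> inv_into total triv \<circ> inv_into V \<psi>) u j" if "j < N" for j
        using that p be'(3)
        by (simp add: inv w c p(1) inv_into_triv be(2) affine_coords_def glue_def ratio_hom_pt)
      ultimately show ?thesis by blast
    qed
    have y: "Ck_on k ?n (\<psi> ` V) (\<lambda>u. ?y u f)" for f k
      unfolding weight_of_def
      by (intro Ck_on_mult Ck_on_chart_vec Ck_on_wgt Ck_on_If Ck_on_const Ck_on_exp Ck_on_proj)
    have "Ck_on k ?n (\<psi> ` V) (\<lambda>u. (\<phi> \<circ> inv_into total triv \<circ> inv_into V \<psi>) u j)"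
      if j: "j < N" for j k
    proof (rule Ck_on_cong_open[OF op _ Ck_on_divide[OF y y]])
      fix u assume "u \<in> \<psi> ` V"
      from val[OF this] j
      show "?y u (b j) / ?y u e = (\<phi> \<circ> inv_into total triv \<circ> inv_into V \<psi>) u j" by blast
      show "?y u e \<noteq> 0" using val[OF \<open>u \<in> \<psi> ` V\<close>] by (metis less_irrefl)
    qed
    then show ?thesis unfolding smooth_on_def dom by blast
  qed
  then show "\<forall>(V, \<psi>)\<in>atlas trivial_manifold. \<forall>(U, \<phi>)\<in>atlas total_manifold.
      smooth_on (card T + (h - 1)) N (\<psi> ` {p \<in> V. inv_into total triv p \<in> U})
        (\<phi> \<circ> inv_into total triv \<circ> inv_into V \<psi>)"
    by fast
qed

lemma smooth_fiber_bundle_total: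
  assumes p: "\<And>q. q \<in> total \<Longrightarrow> p q = proj q"
  shows "smooth_fiber_bundle total_manifold (cube_manifold T) (copies h (Euclidean_manifold (h - 1))) p"
proof (rule trivial_smooth_fiber_bundle)
  have top: "topspace (mtop total_manifold) = total" "topspace (mtop (cube_manifold T)) = cube T"
    unfolding total_manifold_simps cube_manifold_simps
    by (rule topspace_sub_simplex[OF total_subset], rule topspace_cube)
  show "smooth_manifold total_manifold"
    by (rule smooth_manifold_open_simplex[OF openin_total])
  show "smooth_manifold (cube_manifold T)" by (rule smooth_manifold_cube[OF compl_nonempty])
  show "smooth_manifold (copies h (Euclidean_manifold (h - 1)))" by (rule smooth_manifold_copies_Euclidean)
  show "smooth_map total_manifold (cube_manifold T) p" by (rule smooth_map_proj[OF p])
  show "p ` topspace (mtop total_manifold) = topspace (mtop (cube_manifold T))"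
    unfolding top proj_total[symmetric] using p by (rule image_cong[OF refl])
  show "diffeomorphism total_manifold trivial_manifold triv"
    unfolding diffeomorphism_def top trivial_manifold_simps topspace_trivial_top
    using bij_betw_triv smooth_map_triv smooth_map_inv_triv by (intro conjI)
  show "fst (triv q) = p q" if "q \<in> topspace (mtop total_manifold)" for q
    using that p unfolding top by (simp add: triv_def)
qed

section \<open>Identification of the cones with the sheets of the trivialization\<close>

lemma cone_vec:
  fixes x :: "real ^ 'e"
  assumes ss: "set ss = - T - {\<sigma> l}" "distinct ss" and l: "l < h" and M: "M (\<sigma> l) = 0"
    and \<mu>: "\<And>i. i < length ss \<Longrightarrow> \<mu> i = M (ss ! i)"
  shows "x + (\<Sum>i<length ss. \<mu> i *\<^sub>R (map (\<lambda>\<gamma>. vanish \<gamma> x) (map \<gamma> ss) ! i)) = (\<chi> e. x $ e * wgt M e)"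
proof -
  have "(\<Sum>i<length ss. (\<mu> i *\<^sub>R (map (\<lambda>\<gamma>. vanish \<gamma> x) (map \<gamma> ss) ! i)) $ e) =
      x $ e * (\<Sum>s\<in>- T. if e \<in> \<gamma> s then 0 else M s)" for e
  proof -
    have "(\<Sum>i<length ss. (\<mu> i *\<^sub>R (map (\<lambda>\<gamma>. vanish \<gamma> x) (map \<gamma> ss) ! i)) $ e) =
        (\<Sum>i<length ss. x $ e * (if e \<in> \<gamma> (ss ! i) then 0 else M (ss ! i)))"
      by (rule sum.cong) (simp_all add: \<mu> vanish_def)
    also have "\<dots> = (\<Sum>s\<in>- T - {\<sigma> l}. x $ e * (if e \<in> \<gamma> s then 0 else M s))"
      by (rule sum.reindex_bij_betw[OF bij_betw_nth[OF ss(2) refl ss(1)[symmetric]]])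
    \<comment> \<open>The weight at \<open>\<sigma> l\<close> is 0, so the omitted edge can be put
      back into the sum, as \<open>wgt\<close> requires.\<close>
    also have "\<dots> = (\<Sum>s\<in>- T. x $ e * (if e \<in> \<gamma> s then 0 else M s))"
      using \<sigma>_notin[OF l] M by (simp add: sum_diff1)
    finally show ?thesis by (simp only: sum_distrib_left)
  qed
  then show ?thesis
    by (simp only: vec_eq_iff vector_add_component sum_component vec_lambda_beta wgt_def distrib_left mult_1_right)
      simp
qed

text \<open>Here x is any positive representative, whereas \<open>glue\<close> uses the one
  normalized at \<open>\<sigma> l\<close>; the scalar between them disappears in projective
  space.\<close>

lemma hom_pt_eq_glue:
  fixes x :: "real ^ 'e"
  assumes "\<forall>e. 0 < x $ e" and M: "\<And>s. s \<notin> T \<Longrightarrow> M s = weight_of l w s"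
  shows "hom_pt (\<chi> e. x $ e * wgt M e) = glue (hom_pt x) l w"
proof -
  have "wgt M e = wgt (weight_of l w) e" for e by (rule wgt_cong[OF M])
  then have eq: "(\<chi> e. ratio (hom_pt x) e (\<sigma> l) * wgt (weight_of l w) e) =
      (1 / x $ \<sigma> l) *s (\<chi> e. x $ e * wgt M e)"
    by (simp add: vec_eq_iff ratio_hom_pt)
  show ?thesis
    unfolding glue_def eq
    by (rule hom_pt_scale[symmetric]) (use assms(1) in \<open>simp add: less_imp_neq[symmetric]\<close>)
qed

text \<open>Among these sets \<gamma> s is the only one that misses s.\<close>

lemma inj_on_\<gamma>: "inj_on \<gamma> (- T)"
proof (rule inj_onI)
  fix s s' assume "s \<in> - T" "s' \<in> - T" "\<gamma> s = \<gamma> s'"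
  then show "s = s'" using \<gamma>_compl[of s s] \<gamma>_compl[of s' s] by auto
qed

lemma card_compl: "card (- T) = h"
  using bij_betw_same_card[OF bij_\<sigma>] by simp

text \<open>By injectivity of \<gamma> the chosen list comes from h - 1 distinct edges off T.
  Exactly one edge off T is then left out, and it determines the sheet.\<close>

lemma Cone_subset_glue:
  fixes x :: "real ^ 'e"
  assumes x: "\<forall>e. 0 < x $ e" and \<gamma>s: "length \<gamma>s = h - 1" "distinct \<gamma>s" "set \<gamma>s \<subseteq> \<gamma> ` (- T)"
    and q: "q \<in> Cone x (map (\<lambda>\<gamma>. vanish \<gamma> x) \<gamma>s)"
  shows "\<exists>l<h. \<exists>w\<in>topspace (Euclidean_space (h - 1)). q = glue (hom_pt x) l w"
proof -
  define ss where "ss = map (inv_into (- T) \<gamma>) \<gamma>s"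
  have \<gamma>s_eq: "\<gamma>s = map \<gamma> ss"
    using \<gamma>s(3) f_inv_into_f[of _ \<gamma> "- T"] by (auto simp: ss_def o_def intro!: map_idI[symmetric])
  have ss: "set ss \<subseteq> - T" "distinct ss" "length ss = h - 1"
    using \<gamma>s inv_into_into[of _ \<gamma> "- T"] by (auto simp: ss_def distinct_map intro!: inj_on_inv_into)
  have "card (- T - set ss) = 1"
    using ss h_pos by (simp add: card_Diff_subset distinct_card card_compl)
  then obtain s0 where s0: "- T - set ss = {s0}" using card_1_singletonE by blast
  obtain l where l: "l < h" "\<sigma> l = s0"
    using bij_\<sigma> s0 by (metis DiffD1 bij_betw_iff_bijections insertI1 lessThan_iff)
  have set_ss: "set ss = - T - {\<sigma> l}" using s0 ss(1) l(2) by blast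
  obtain \<mu> where \<mu>: "q = hom_pt (x + (\<Sum>i<length ss. \<mu> i *\<^sub>R (map (\<lambda>\<gamma>. vanish \<gamma> x) (map \<gamma> ss) ! i)))"
    "\<forall>i<length ss. 0 < \<mu> i"
    using q unfolding Cone_def \<gamma>s_eq length_map mem_Collect_eq by (elim exE conjE) (rule that)
  have bij: "bij_betw ((!) ss) {..<length ss} (- T - {\<sigma> l})"
    by (rule bij_betw_nth[OF ss(2) refl set_ss[symmetric]])
  \<comment> \<open>The weights of the cone, reindexed from list positions to edges, with 0 at the
    omitted edge.\<close>
  define M where "M s = (if s = \<sigma> l then 0 else \<mu> (inv_into {..<length ss} ((!) ss) s))" for s
  \<comment> \<open>The logarithms are listed in the order of \<open>c l\<close>, which may differ
    from the order of the given list.\<close>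
  define w where "w i = (if i < h - 1 then ln (M (c l i)) else 0)" for i
  have "\<mu> i = M (ss ! i)" if "i < length ss" for i
  proof -
    have "ss ! i \<noteq> \<sigma> l" using set_ss nth_mem[OF that] by auto
    then show ?thesis
      using bij that inv_into_f_f[of "(!) ss" "{..<length ss}" i] by (simp add: M_def bij_betw_def)
  qed
  then have vec: "x + (\<Sum>i<length ss. \<mu> i *\<^sub>R (map (\<lambda>\<gamma>. vanish \<gamma> x) (map \<gamma> ss) ! i)) = (\<chi> e. x $ e * wgt M e)"
    by (intro cone_vec[OF set_ss ss(2) l(1)]) (simp add: M_def)
  have "M s = weight_of l w s" if "s \<notin> T" for s
  proof (cases "s = \<sigma> l")
    case False
    then have "s \<in> (!) ss ` {..<length ss}" using bij that by (simp add: bij_betw_def)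
    then have "inv_into {..<length ss} ((!) ss) s < length ss"
      using inv_into_into[of s "(!) ss" "{..<length ss}"] by simp
    then have "0 < M s" using False \<mu>(2) by (simp add: M_def)
    then show ?thesis
      using c_surj[OF l(1) that False] False by (simp add: weight_of_def w_def)
  qed (simp add: M_def weight_of_def)
  then have "q = glue (hom_pt x) l w"
    unfolding \<mu>(1) vec by (rule hom_pt_eq_glue[OF x])
  moreover have "w \<in> topspace (Euclidean_space (h - 1))"
    by (simp add: w_def topspace_Euclidean_space)
  ultimately show ?thesis using l(1) by blast
qed

lemma glue_in_Cone:
  fixes x :: "real ^ 'e"
  assumes x: "\<forall>e. 0 < x $ e" and l: "l < h"
  shows "\<exists>\<gamma>s. length \<gamma>s = h - 1 \<and> distinct \<gamma>s \<and> set \<gamma>s \<subseteq> \<gamma> ` (- T) \<and>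
    glue (hom_pt x) l w \<in> Cone x (map (\<lambda>\<gamma>. vanish \<gamma> x) \<gamma>s)"
proof -
  obtain ss where ss: "set ss = - T - {\<sigma> l}" "distinct ss"
    using finite_distinct_list[of "- T - {\<sigma> l}"] by auto
  have len: "length ss = h - 1"
    using distinct_card[OF ss(2)] \<sigma>_notin[OF l] by (simp add: ss(1) card_compl)
  have "distinct (map \<gamma> ss)"
    using ss inj_on_subset[OF inj_on_\<gamma>, of "- T - {\<sigma> l}"] by (simp add: distinct_map)
  moreover have "glue (hom_pt x) l w \<in> Cone x (map (\<lambda>\<gamma>. vanish \<gamma> x) (map \<gamma> ss))"
    unfolding Cone_def length_map mem_Collect_eq
  proof (intro exI[of _ "\<lambda>i. weight_of l w (ss ! i)"] conjI allI impI)
    show "glue (hom_pt x) l w =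
        hom_pt (x + (\<Sum>i<length ss. weight_of l w (ss ! i) *\<^sub>R (map (\<lambda>\<gamma>. vanish \<gamma> x) (map \<gamma> ss) ! i)))"
      using cone_vec[OF ss l, of "weight_of l w" "\<lambda>i. weight_of l w (ss ! i)" x]
        hom_pt_eq_glue[OF x, of "weight_of l w" l w]
      by (simp add: weight_of_def[of l w "\<sigma> l"])
    show "0 < weight_of l w (ss ! i)" if "i < length ss" for i
      using nth_mem[OF that] ss(1) by (simp add: weight_of_def)
  qed
  ultimately show ?thesis
    using len ss(1) by (intro exI[of _ "map \<gamma> ss"]) auto
qed

text \<open>The graph enters only here. The two inclusions are what
  \<open>max_core_subgraphs_subset\<close> provides; the second is restricted to h at least
  2.\<close>

context
  fixes G :: "('v::finite, 'e) graph"
  assumes betti: "betti G UNIV = h"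
    and max_core: "max_core_subgraphs G T \<subseteq> \<gamma> ` (- T)"
      "2 \<le> h \<Longrightarrow> \<gamma> ` (- T) \<subseteq> max_core_subgraphs G T"
begin

lemma pi_fiber_iff:
  assumes p: "p \<in> cube T"
  shows "q \<in> pi_fiber G T p \<longleftrightarrow> (\<exists>l w. (p, l, w) \<in> trivial_space \<and> q = glue p l w)"
proof
  assume "q \<in> pi_fiber G T p"
  then obtain x \<gamma>s where x: "\<forall>e. 0 < x $ e" "hom_pt x = p"
    and \<gamma>s: "length \<gamma>s = h - 1" "distinct \<gamma>s" "set \<gamma>s \<subseteq> max_core_subgraphs G T"
    and q: "q \<in> Cone x (map (\<lambda>\<gamma>. vanish \<gamma> x) \<gamma>s)"
    unfolding pi_fiber_def betti Union_iff mem_Collect_eq by blast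
  have "\<exists>l<h. \<exists>w\<in>topspace (Euclidean_space (h - 1)). q = glue (hom_pt x) l w"
    by (rule Cone_subset_glue[OF x(1) \<gamma>s(1,2) order_trans[OF \<gamma>s(3) max_core(1)] q])
  then show "\<exists>l w. (p, l, w) \<in> trivial_space \<and> q = glue p l w"
    using p unfolding x(2) by blast
next
  assume "\<exists>l w. (p, l, w) \<in> trivial_space \<and> q = glue p l w"
  then obtain l w where l: "l < h" and q: "q = glue p l w" by blast
  have p': "p \<in> open_simplex" using p cube_subset[OF compl_nonempty] by blast
  \<comment> \<open>The representative normalized at \<open>\<sigma> l\<close>;
    \<open>pi_fiber\<close> allows every positive representative, so this choice is
    admissible.\<close>
  define x where "x = (\<chi> e. ratio p e (\<sigma> l))"
  have x: "\<forall>e. 0 < x $ e" "hom_pt x = p"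
    by (simp_all add: x_def hom_pt_ratio[OF p'])
  obtain \<gamma>s where \<gamma>s: "length \<gamma>s = h - 1" "distinct \<gamma>s" "set \<gamma>s \<subseteq> \<gamma> ` (- T)"
    "q \<in> Cone x (map (\<lambda>\<gamma>. vanish \<gamma> x) \<gamma>s)"
    using glue_in_Cone[OF x(1) l, of w] unfolding x(2) q by blast
  have "set \<gamma>s \<subseteq> max_core_subgraphs G T"
  proof (cases "2 \<le> h")
    \<comment> \<open>For h = 1 the list of generators is empty, so its inclusion in the maximal
      elements is trivial.\<close>
    case False
    then have "\<gamma>s = []" using \<gamma>s(1) by simp
    then show ?thesis by simp
  qed (use \<gamma>s(3) max_core(2) in blast)
  then show "q \<in> pi_fiber G T p"
    unfolding pi_fiber_def betti using x \<gamma>s by blast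
qed

lemma D_T_eq: "D_T G T = total"
proof (intro equalityI subsetI)
  fix q assume "q \<in> D_T G T"
  then obtain p l w where "(p, l, w) \<in> trivial_space" "q = glue p l w"
    unfolding D_T_def using pi_fiber_iff by blast
  then show "q \<in> total" using triv_glue(1) by blast
next
  fix q assume "q \<in> total"
  then obtain l where l: "l < h" "q \<in> piece l" by (rule totalE)
  then have "base l q \<in> cube T" "q \<in> pi_fiber G T (base l q)"
    using base_in_cube[OF l] logs_in_Euclidean[of l q] glue_base_logs[OF l]
    by (auto simp: pi_fiber_iff intro!: exI[of _ l] exI[of _ "logs l q"])
  then show "q \<in> D_T G T" unfolding D_T_def by blast
qed

text \<open>Uniqueness in the definite description holds because membership in the fiber over p
  forces \<open>triv q\<close> to have first component p; this is the disjointness of the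
  fibers.\<close>

lemma pi_T_eq:
  assumes "q \<in> total"
  shows "pi_T G T q = proj q"
  unfolding pi_T_def
proof (rule the_equality)
  obtain l where l: "l < h" "q \<in> piece l" using assms by (rule totalE)
  have "(base l q, l, logs l q) \<in> trivial_space"
    using base_in_cube[OF l] l(1) logs_in_Euclidean[of l q] by blast
  then show "proj q \<in> cube T \<and> q \<in> pi_fiber G T (proj q)"
    unfolding proj_eq[OF l] using base_in_cube[OF l] glue_base_logs[OF l, symmetric] pi_fiber_iff by blast
next
  fix p assume p: "p \<in> cube T \<and> q \<in> pi_fiber G T p"
  then obtain l w where "(p, l, w) \<in> trivial_space" "q = glue p l w"
    using pi_fiber_iff by blast
  then have "triv q = (p, l, w)" using triv_glue(2) by blast
  then show "p = proj q" by (simp add: triv_def)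
qed

end

end

theorem proposition2p6:
  fixes G :: "('v::finite, 'e::finite) graph" and T :: "'e set"
  assumes "connected_graph G UNIV"
    and "\<forall>e. \<not> tadpole G e"
    and "betti G UNIV \<ge> 1"
    and "spanning_tree G T"
  shows "smooth_fiber_bundle (D_manifold G T) (cube_manifold T)
           (copies (betti G UNIV) (Euclidean_manifold (CARD('e) - card T - 1))) (pi_T G T)
         \<and> CARD('e) - card T - 1 = betti G UNIV - 1"
proof -
  define h where "h = betti G UNIV"
  have h: "h = card (- T)" "0 < h"
    using betti_eq_card_compl[OF assms(4)] assms(3) by (simp_all add: h_def)
  obtain \<sigma> where \<sigma>: "bij_betw \<sigma> {..<h} (- T)"
    using ex_bij_betw_nat_finite[OF finite[of "- T"]] unfolding h(1) atLeast0LessThan by blast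
  \<comment> \<open>The bound on l stays inside the existential, so that \<open>choice\<close>
    applies to all l.\<close>
  have "\<forall>l. \<exists>b. l < h \<longrightarrow> bij_betw b {..<h - 1} (- T - {\<sigma> l})"
  proof
    fix l
    show "\<exists>b. l < h \<longrightarrow> bij_betw b {..<h - 1} (- T - {\<sigma> l})"
    proof (cases "l < h")
      case True
      then have "\<sigma> l \<in> - T" using \<sigma> by (auto simp: bij_betw_def)
      then have "card (- T - {\<sigma> l}) = h - 1" by (simp add: h(1))
      then show ?thesis
        using ex_bij_betw_nat_finite[OF finite[of "- T - {\<sigma> l}"]] unfolding atLeast0LessThan by metis
    qed simp
  qed
  then obtain c where c: "\<forall>l. l < h \<longrightarrow> bij_betw (c l) {..<h - 1} (- T - {\<sigma> l})"
    by (rule choice[THEN exE])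
  interpret cone_fibration T "core_without G" h \<sigma> c
  proof
    show "t \<in> core_without G s \<longleftrightarrow> t \<noteq> s" if "s \<notin> T" "t \<notin> T" for s t
      using in_core_without_iff[of G T s t] assms(4) that by (simp add: spanning_tree_def)
  qed (use h \<sigma> c in simp_all)
  note max_core = max_core_subgraphs_subset[OF assms(4,2), folded h(1)]
  have dim: "CARD('e) - card T - 1 = h - 1"
    using N_eq unfolding N_def by simp
  have "D_T G T = total"
    by (rule D_T_eq[OF h_def[symmetric] max_core])
  then have "D_manifold G T = total_manifold"
    by (simp only: D_manifold_def)
  then have "smooth_fiber_bundle (D_manifold G T) (cube_manifold T)
      (copies h (Euclidean_manifold (h - 1))) (pi_T G T)"
    using smooth_fiber_bundle_total[OF pi_T_eq[OF h_def[symmetric] max_core]] by simp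
  then show ?thesis using dim by (simp only: h_def simp_thms)
qed

end
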